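(* Let $\alpha(t)=(y_1(t),y_2(t))$, $t\in\mathbb{R}$, be a solution of $$\ddot y_1=\frac{\partial\omega}{\partial y_1}+2\dot y_2,\qquad \ddot y_2=\frac{\partial\omega}{\partial y_2}-2\dot y_1$$ with Jacobian integral equal to $C$. Assume that: (i) $\alpha$ is periodic: there is $T>0$ such that $\alpha(t+T)=\alpha(t)$ for all $t\in\mathbb{R}$; (ii) $\alpha$ is regular: $|\dot\alpha(t)|\neq 0$ for all $t\in\mathbb{R}$; (iii) $\alpha$ is simple: $\alpha:[0,T)\to\mathbb{R}^2$ is injective; (iv) the region $\Omega$ enclosed by the curve $\alpha$ is contained in $U_C$. Let $f=\sqrt{2\omega-C}$. Then: - if $\alpha$ goes clockwise around $\Omega$, then $\displaystyle 2T=2\pi+\iint_\Omega \Delta\ln f\,dy_1dy_2$; - if $\alpha$ goes counterclockwise around $\Omega$, then $\displaystyle 2T=-2\pi-\iint_\Omega \Delta\ln f\,dy_1dy_2$.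
   Context: Fix a real number $\mu$ with $0<\mu\le \frac12$ (mass parameter of the planar circular restricted three body problem, in rotating coordinates). On $\mathbb{R}^2\setminus\{(-\mu,0),(1-\mu,0)\}$ define $$\omega(y_1,y_2)=\frac12(y_1^2+y_2^2)+\frac{1-\mu}{\sqrt{(y_1+\mu)^2+y_2^2}}+\frac{\mu}{\sqrt{(y_1+\mu-1)^2+y_2^2}}.$$ For every solution of the differential equation the quantity $-\dot y_1^2-\dot y_2^2+2\omega(y_1,y_2)$ is a constant $C$, called its Jacobian integral. For a constant $C$, $U_C=\{(y_1,y_2): 2\omega(y_1,y_2)-C\ge 0\}$, where the two points $(-\mu,0)$ and $(1-\mu,0)$ (at which $\omega$ is undefined) are not considered part of $U_C$. $\Delta=\partial_{y_1}^2+\partial_{y_2}^2$ is the Laplacian. The region enclosed by a simple closed curve is the bounded component of its complement.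
   Formalization: The formal statement also assumes f > 0 on Ω; this excludes only the case where Ω contains L4 or L5 and C = 2ω there, in which ln f is undefined at that point and the double integral of Δ ln f does not converge absolutely. *)

theory Defs
  imports "HOL-Complex_Analysis.Complex_Analysis"
begin

definition partial1 :: "(real \<times> real \<Rightarrow> real) \<Rightarrow> real \<times> real \<Rightarrow> real" where
  "partial1 g p = deriv (\<lambda>x. g (x, snd p)) (fst p)"

definition partial2 :: "(real \<times> real \<Rightarrow> real) \<Rightarrow> real \<times> real \<Rightarrow> real" where
  "partial2 g p = deriv (\<lambda>y. g (fst p, y)) (snd p)"

definition laplacian :: "(real \<times> real \<Rightarrow> real) \<Rightarrow> real \<times> real \<Rightarrow> real" where
  "laplacian g p = partial1 (partial1 g) p + partial2 (partial2 g) p"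

definition primaries :: "real \<Rightarrow> (real \<times> real) set" where
  "primaries \<mu> = {(-\<mu>, 0), (1 - \<mu>, 0)}"

text \<open>Only meaningful off \<open>primaries \<mu>\<close>; every use below excludes these two points explicitly.\<close>
definition omega :: "real \<Rightarrow> real \<times> real \<Rightarrow> real" where
  "omega \<mu> = (\<lambda>(y1, y2). (y1\<^sup>2 + y2\<^sup>2) / 2
     + (1 - \<mu>) / sqrt ((y1 + \<mu>)\<^sup>2 + y2\<^sup>2)
     + \<mu> / sqrt ((y1 + \<mu> - 1)\<^sup>2 + y2\<^sup>2))"

definition velocity :: "(real \<Rightarrow> real \<times> real) \<Rightarrow> real \<Rightarrow> real \<times> real" where
  "velocity \<alpha> t = vector_derivative \<alpha> (at t)"

definition pcr3bp_solution :: "real \<Rightarrow> (real \<Rightarrow> real \<times> real) \<Rightarrow> bool" where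
  "pcr3bp_solution \<mu> \<alpha> \<longleftrightarrow> (\<forall>t.
     \<alpha> t \<notin> primaries \<mu> \<and>
     \<alpha> differentiable (at t) \<and>
     velocity \<alpha> differentiable (at t) \<and>
     fst (velocity (velocity \<alpha>) t) = partial1 (omega \<mu>) (\<alpha> t) + 2 * snd (velocity \<alpha> t) \<and>
     snd (velocity (velocity \<alpha>) t) = partial2 (omega \<mu>) (\<alpha> t) - 2 * fst (velocity \<alpha> t))"

definition jacobian_integral :: "real \<Rightarrow> (real \<Rightarrow> real \<times> real) \<Rightarrow> real \<Rightarrow> bool" where
  "jacobian_integral \<mu> \<alpha> C \<longleftrightarrow>
     (\<forall>t. - (fst (velocity \<alpha> t))\<^sup>2 - (snd (velocity \<alpha> t))\<^sup>2 + 2 * omega \<mu> (\<alpha> t) = C)"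

definition U :: "real \<Rightarrow> real \<Rightarrow> (real \<times> real) set" where
  "U \<mu> C = {p. p \<notin> primaries \<mu> \<and> 2 * omega \<mu> p - C \<ge> 0}"

text \<open>\<open>U \<mu> C\<close> admits zeros of \<open>2 * omega \<mu> p - C\<close>, where \<open>ln (speed \<mu> C p)\<close> is undefined. Inside a
  region contained in \<open>U \<mu> C\<close> such a zero is an interior minimum of \<open>omega \<mu>\<close>, i.e. an equilateral
  Lagrange point at exactly its own Jacobi level, and there the Laplacian of \<open>ln (speed \<mu> C p)\<close>
  is not absolutely integrable. Hence integrating it presupposes \<open>speed \<mu> C p > 0\<close> on the region.\<close>
definition speed :: "real \<Rightarrow> real \<Rightarrow> real \<times> real \<Rightarrow> real" where
  "speed \<mu> C p = sqrt (2 * omega \<mu> p - C)"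

text \<open>For a simple closed curve, \<open>inside\<close> of its image is the bounded component of the complement.\<close>
definition enclosed_region :: "(real \<Rightarrow> real \<times> real) \<Rightarrow> (real \<times> real) set" where
  "enclosed_region \<alpha> = inside (range \<alpha>)"

definition to_complex :: "real \<times> real \<Rightarrow> complex" where
  "to_complex p = Complex (fst p) (snd p)"

text \<open>One period of \<open>\<alpha>\<close>, reparametrised over \<open>[0, 1]\<close> and read in the complex plane, where
  the orientation of a simple closed curve is the sign of its winding number about the points
  it encloses.\<close>
definition period_loop :: "(real \<Rightarrow> real \<times> real) \<Rightarrow> real \<Rightarrow> real \<Rightarrow> complex" where
  "period_loop \<alpha> T s = to_complex (\<alpha> (T * s))"

definition goes_counterclockwise :: "(real \<Rightarrow> real \<times> real) \<Rightarrow> real \<Rightarrow> bool" where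
  "goes_counterclockwise \<alpha> T \<longleftrightarrow>
     (\<forall>p \<in> enclosed_region \<alpha>. winding_number (period_loop \<alpha> T) (to_complex p) = 1)"

definition goes_clockwise :: "(real \<Rightarrow> real \<times> real) \<Rightarrow> real \<Rightarrow> bool" where
  "goes_clockwise \<alpha> T \<longleftrightarrow>
     (\<forall>p \<in> enclosed_region \<alpha>. winding_number (period_loop \<alpha> T) (to_complex p) = -1)"

end

theory Submission imports Defs begin

text \<open>
  Write the velocity as a complex number \<open>\<alpha>' = f exp (\<i> \<theta>)\<close> with \<open>f = \<bar>\<alpha>'\<bar> = sqrt (2 \<omega> - C)\<close>. The equation of
  motion gives \<open>\<theta>' = \<nabla>(ln f) \<bullet> (\<i> \<alpha>') - 2\<close>, the \<open>- 2\<close> coming from the Coriolis force. Over one period the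
  left-hand side integrates to \<open>2 \<pi> w\<close> with \<open>w = \<plusminus>1\<close> the winding number (Hopf's Umlaufsatz), and the
  flux of \<open>\<nabla>(ln f)\<close> is \<open>- w\<close> times the integral of its Laplacian (Green's theorem).

  Green's theorem comes without any boundary regularity from the Cauchy-Pompeiu formula: a
  compactly supported \<open>C\<^sup>1\<close> function is the Cauchy transform of its antiholomorphic derivative, and
  integrating this along the loop turns the kernel into the winding number by Fubini. For the
  Umlaufsatz, a continuous logarithm of the normalised secants of the loop is followed from the
  tangents to the secants through a lowest point; the sign of the tangent at that point is matched
  with \<open>w\<close> by applying Green's theorem to a function concentrated near it.
\<close>

section \<open>Local integrability of the Cauchy kernel\<close>

text \<open>Two geometric facts are read off one complex identity: the integral of
  \<open>g dz\<close> along the loop is \<open>\<i> * w\<close> times the area integral of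
  \<open>gx + \<i> * gy\<close>. For the conjugate gradient of \<open>ln f\<close> the mixed
  derivatives cancel, \<open>gx + \<i> * gy\<close> is the Laplacian, and the imaginary part is the
  flux. For a real bump at the lowest point, the real part compares the tangent there with
  \<open>w\<close>.

  The shape of the proof is dictated by what is known about the region: it is only the
  \<open>inside\<close> of a curve, and its orientation only the winding number of its points. The
  winding number is itself an integral of the Cauchy kernel, so Fubini brings in exactly this datum.

  \<open>ln f\<close> degenerates at the primaries and where the speed vanishes. The enclosed points
  avoid both by assumption and the curve by regularity of the orbit, so \<open>ln f\<close> is
  \<open>C^2\<close> on an open neighbourhood of a compact set and its gradient can be cut off
  there.

  The Coriolis acceleration is \<open>- 2 * \<i>\<close> times the velocity, a constant multiple
  whatever the speed. It therefore turns the velocity at the constant rate \<open>- 2\<close>, and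
  this is how the period enters the formula.\<close>

lemma lborel_integral_iterated:
  fixes f :: "'a::euclidean_space \<times> 'b::euclidean_space \<Rightarrow> 'c::{banach, second_countable_topology}"
  assumes "integrable lborel f"
  shows "integral\<^sup>L lborel f = (LINT x|lborel. LINT y|lborel. f (x, y))"
    and "integral\<^sup>L lborel f = (LINT y|lborel. LINT x|lborel. f (x, y))"
proof -
  have int: "integrable (lborel \<Otimes>\<^sub>M lborel) (\<lambda>(x, y). f (x, y))"
    using assms by (simp add: lborel_prod)
  show "integral\<^sup>L lborel f = (LINT x|lborel. LINT y|lborel. f (x, y))"
    using lborel_pair.integral_fst[OF int] by (simp add: lborel_prod)
  show "integral\<^sup>L lborel f = (LINT y|lborel. LINT x|lborel. f (x, y))"
    using lborel_pair.integral_snd[OF int] by (simp add: lborel_prod)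
qed

lemma lborel_integrable_product:
  fixes f :: "'a::euclidean_space \<Rightarrow> real" and g :: "'b::euclidean_space \<Rightarrow> real"
  assumes f: "integrable lborel f" and g: "integrable lborel g"
  shows "integrable lborel (\<lambda>p. f (fst p) * g (snd p))"
proof -
  have "integrable (lborel \<Otimes>\<^sub>M lborel) (\<lambda>p. f (fst p) * g (snd p))"
  proof (rule lborel_pair.Fubini_integrable)
    show "(\<lambda>p. f (fst p) * g (snd p)) \<in> borel_measurable (lborel \<Otimes>\<^sub>M lborel)"
      using borel_measurable_integrable[OF f] borel_measurable_integrable[OF g] by measurable
    show "AE x in lborel. integrable lborel (\<lambda>y. f (fst (x, y)) * g (snd (x, y)))"
      using g by simp
    show "integrable lborel (\<lambda>x. LINT y|lborel. norm (f (fst (x, y)) * g (snd (x, y))))"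
      using f by (simp add: abs_mult)
  qed
  then show ?thesis
    by (simp add: lborel_prod)
qed

lemma integrable_inverse_sqrt_abs:
  fixes R :: real
  shows "integrable lborel (\<lambda>x. indicator {-R..R} x *\<^sub>R (\<bar>x\<bar> powr (-1/2)))"
proof (cases "R \<ge> 0")
  case True
  have "((\<lambda>x. x powr (-1/2)) has_integral (R powr (-1/2 + 1) / (-1/2 + 1))) {0..R}"
    using True by (intro has_integral_powr_from_0) auto
  then have "((\<lambda>x. \<bar>x\<bar> powr (-1/2)) has_integral (R powr (-1/2 + 1) / (-1/2 + 1))) {0..R}"
    by (rule has_integral_eq[rotated]) auto
  then have "(\<lambda>x. \<bar>x\<bar> powr (-1/2)) integrable_on {0..R}"
    by blast
  then have pos: "(\<lambda>x. \<bar>x\<bar> powr (-1/2)) absolutely_integrable_on {0..R}"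
    by (rule nonnegative_absolutely_integrable_1) auto
  have neg: "(\<lambda>x. \<bar>x\<bar> powr (-1/2)) absolutely_integrable_on {-R..0}"
    by (subst absolutely_integrable_reflect_real[symmetric]) (use pos in simp)
  have "{-R..0} \<union> {0..R} = {-R..R}"
    using True by auto
  then have "(\<lambda>x. \<bar>x\<bar> powr (-1/2)) absolutely_integrable_on {-R..R}"
    using set_integrable_Un[OF neg pos] by simp
  then show ?thesis
    unfolding set_integrable_def by (subst (asm) integrable_completion) auto
qed simp

lemma two_abs_mult_le_norm_power2: "2 * (\<bar>fst p\<bar> * \<bar>snd p\<bar>) \<le> (norm (p :: real \<times> real))\<^sup>2"
proof -
  have "0 \<le> (\<bar>fst p\<bar> - \<bar>snd p\<bar>)\<^sup>2"
    by simp
  then show ?thesis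
    by (simp add: norm_prod_def power2_eq_square algebra_simps)
qed

text \<open>By AM-GM, \<open>1 / norm (x, y)\<close> is at most the product of \<open>\<bar>x\<bar> powr (-1/2)\<close> and \<open>\<bar>y\<bar> powr (-1/2)\<close>.\<close>
lemma integrable_inverse_norm_prod:
  "integrable lborel (\<lambda>p::real \<times> real. indicator (ball 0 R) p *\<^sub>R inverse (norm p))"
proof (rule Bochner_Integration.integrable_bound)
  let ?h = "\<lambda>x::real. indicator {-R..R} x *\<^sub>R (\<bar>x\<bar> powr (-1/2))"
  show "integrable lborel (\<lambda>p. ?h (fst p) * ?h (snd p))"
    by (intro lborel_integrable_product integrable_inverse_sqrt_abs)
  show "(\<lambda>p::real \<times> real. indicator (ball 0 R) p *\<^sub>R inverse (norm p)) \<in> borel_measurable lborel"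
    unfolding measurable_lborel1
    by (intro borel_measurable_scaleR borel_measurable_indicator borel_measurable_inverse
        borel_measurable_norm) auto
  \<comment> \<open>The axes have to be excluded: \<open>0 powr (-1/2)\<close> is \<open>0\<close>
    by convention, so the product bound fails at their points other than the origin.\<close>
  have "AE p :: real \<times> real in lborel. fst p \<noteq> 0 \<and> snd p \<noteq> 0"
  proof -
    have "AE p :: real \<times> real in lborel \<Otimes>\<^sub>M lborel. fst p \<noteq> 0 \<and> snd p \<noteq> 0"
    proof (rule lborel_pair.AE_pair_measure)
      show "{p \<in> space (lborel \<Otimes>\<^sub>M lborel). fst p \<noteq> 0 \<and> snd p \<noteq> 0} \<in> sets (lborel \<Otimes>\<^sub>M lborel)"
        by measurable
      show "AE x::real in lborel. AE y::real in lborel. fst (x, y) \<noteq> 0 \<and> snd (x, y) \<noteq> 0"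
        using AE_lborel_singleton[of "0::real"] by (auto simp: eventually_conj_iff)
    qed
    then show ?thesis unfolding lborel_prod .
  qed
  then show "AE p in lborel. norm (indicator (ball 0 R) p *\<^sub>R inverse (norm p)) \<le> norm (?h (fst p) * ?h (snd p))"
  proof eventually_elim
    case (elim p)
    have n: "\<bar>fst p\<bar> \<le> norm p" "\<bar>snd p\<bar> \<le> norm p"
      by (metis norm_fst_le prod.collapse real_norm_def) (metis norm_snd_le prod.collapse real_norm_def)
    have "inverse (norm p) \<le> \<bar>fst p\<bar> powr (-1/2) * \<bar>snd p\<bar> powr (-1/2)"
    proof -
      have pos: "\<bar>fst p\<bar> * \<bar>snd p\<bar> > 0"
        using elim by simp
      have "\<bar>fst p\<bar> * \<bar>snd p\<bar> \<le> (norm p)\<^sup>2"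
        using two_abs_mult_le_norm_power2[of p] pos by linarith
      then have "sqrt (\<bar>fst p\<bar> * \<bar>snd p\<bar>) \<le> norm p"
        by (simp add: real_le_lsqrt)
      then have "inverse (norm p) \<le> inverse (sqrt (\<bar>fst p\<bar> * \<bar>snd p\<bar>))"
        using pos by (intro le_imp_inverse_le) auto
      also have "\<dots> = \<bar>fst p\<bar> powr (-1/2) * \<bar>snd p\<bar> powr (-1/2)"
        using elim by (simp add: powr_minus powr_half_sqrt real_sqrt_mult)
      finally show ?thesis .
    qed
    then show ?case
      using n by (auto simp: indicator_def)
  qed
qed

text \<open>The fundamental theorem of calculus on an interval outside which \<open>h\<close> and
  \<open>h'\<close> vanish. The finite set \<open>S\<close> will consist of the points where a
  coordinate line meets the circle on which the regularised kernel has a kink. If \<open>h'\<close>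
  is not integrable, its Bochner integral is \<open>0\<close> by convention.\<close>

lemma lborel_integral_derivative_zero:
  fixes h :: "real \<Rightarrow> 'a::euclidean_space"
  assumes "finite S" and der: "\<And>t. t \<notin> S \<Longrightarrow> (h has_vector_derivative h' t) (at t)"
    and cont: "continuous_on UNIV h"
    and supp: "\<And>t. R \<le> \<bar>t\<bar> \<Longrightarrow> h t = 0 \<and> h' t = 0"
  shows "(LINT t|lborel. h' t) = 0"
proof (cases "integrable lborel h'")
  case True
  define R' where "R' = max R 0"
  have "(h' has_integral (h R' - h (-R'))) {-R'..R'}"
    by (rule fundamental_theorem_of_calculus_interior_strong[OF \<open>finite S\<close>])
      (auto intro: der continuous_on_subset[OF cont] simp: R'_def)
  moreover have "h R' = 0" "h (-R') = 0"
    by (auto intro!: conjunct1[OF supp] simp: R'_def)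
  ultimately have "(h' has_integral 0) {-R'..R'}"
    by simp
  moreover have "h' t = 0" if "t \<notin> {-R'..R'}" for t
    using that by (intro conjunct2[OF supp]) (auto simp: R'_def)
  ultimately have "(h' has_integral 0) UNIV"
    by (rule has_integral_on_superset) auto
  then show ?thesis
    using has_integral_integral_lborel[OF True] has_integral_unique by blast
qed (simp add: not_integrable_integral_eq)

text \<open>The Cauchy kernel \<open>1 / z\<close>, made continuous inside the disc of radius \<open>e\<close> so that its
  antiholomorphic derivative is \<open>1 / e\<^sup>2\<close> times the indicator function of that disc.\<close>
definition reg_kernel :: "real \<Rightarrow> complex \<Rightarrow> complex" where
  "reg_kernel e z = cnj z / of_real (max ((cmod z)\<^sup>2) (e\<^sup>2))"

lemma reg_kernel_outside: "0 \<le> e \<Longrightarrow> e \<le> cmod z \<Longrightarrow> reg_kernel e z = inverse z"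
proof -
  assume "0 \<le> e" "e \<le> cmod z"
  then have "max ((cmod z)\<^sup>2) (e\<^sup>2) = (cmod z)\<^sup>2"
    by (simp add: max_absorb1 power_mono)
  then have "reg_kernel e z = cnj z / (z * cnj z)"
    unfolding reg_kernel_def by (metis complex_norm_square)
  then show ?thesis
    by (cases "z = 0") (simp_all add: divide_inverse)
qed

lemma reg_kernel_inside: "cmod z \<le> e \<Longrightarrow> reg_kernel e z = cnj z / (of_real e)\<^sup>2"
  by (simp add: reg_kernel_def max_absorb2 power_mono)

lemma continuous_on_reg_kernel:
  assumes "0 < e"
  shows "continuous_on UNIV (reg_kernel e)"
proof -
  have "max ((cmod z)\<^sup>2) (e\<^sup>2) > 0" for z
    using assms by (simp add: less_max_iff_disj)
  then have "complex_of_real (max ((cmod z)\<^sup>2) (e\<^sup>2)) \<noteq> 0" for z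
    by (metis less_irrefl of_real_eq_0_iff)
  then show ?thesis
    unfolding reg_kernel_def by (intro continuous_intros) blast
qed

text \<open>This bound is uniform in \<open>e\<close> and supplies the dominating function for the
  limit \<open>e -> 0\<close>; the bound \<open>inverse e\<close> of
  \<open>norm_reg_kernel_le\<close> handles integrability for a fixed \<open>e\<close>.\<close>

lemma norm_reg_kernel_le_inverse_norm:
  assumes "0 < e"
  shows "cmod (reg_kernel e z) \<le> inverse (cmod z)"
proof (cases "e \<le> cmod z")
  case True
  then show ?thesis
    using assms by (simp add: reg_kernel_outside norm_inverse)
next
  case False
  then have "cmod z * cmod z \<le> e\<^sup>2"
    unfolding power2_eq_square using assms by (intro mult_mono) auto
  then show ?thesis
    using False assms by (cases "z = 0")
      (auto simp: reg_kernel_inside norm_divide norm_power divide_simps)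
qed

lemma norm_reg_kernel_le:
  assumes "0 < e"
  shows "cmod (reg_kernel e z) \<le> inverse e"
proof (cases "e \<le> cmod z")
  case True
  then show ?thesis
    using assms by (simp add: reg_kernel_outside norm_inverse le_imp_inverse_le)
next
  case False
  then show ?thesis
    using assms by (simp add: reg_kernel_inside norm_divide norm_power divide_simps) (simp add: power2_eq_square)
qed

text \<open>The derivative of \<open>reg_kernel e\<close> in direction \<open>d\<close>; the
  directions \<open>1\<close> and \<open>\<i>\<close> give the two partial derivatives. On the
  circle \<open>cmod z = e\<close>, where the kernel is not differentiable, the outer formula serves
  as a default.\<close>

definition reg_kernel_deriv :: "real \<Rightarrow> complex \<Rightarrow> complex \<Rightarrow> complex" where
  "reg_kernel_deriv e d z = (if cmod z < e then cnj d / (of_real e)\<^sup>2 else - d / z\<^sup>2)"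

lemma has_vector_derivative_transform_eventually:
  assumes "(f has_vector_derivative f') (at x)" and ev: "\<forall>\<^sub>F y in nhds x. f y = g y"
  shows "(g has_vector_derivative f') (at x)"
proof -
  have "f x = g x"
    using ev by (rule eventually_nhds_x_imp_x)
  then show ?thesis
    using assms(1) has_vector_derivative_cong_ev[of UNIV f g x f'] eventually_mono[OF ev] by simp
qed

lemma has_vector_derivative_reg_kernel:
  assumes "0 < e" and c: "(c has_vector_derivative d) (at t)" and ne: "cmod (c t) \<noteq> e"
  shows "((\<lambda>t. reg_kernel e (c t)) has_vector_derivative reg_kernel_deriv e d (c t)) (at t)"
proof -
  have cont: "isCont c t"
    using c by (rule has_vector_derivative_continuous)
  show ?thesis
  proof (cases "cmod (c t) < e")
    case True
    then have ev: "\<forall>\<^sub>F s in nhds t. cmod (c s) < e"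
      using cont by (intro order_tendstoD(2)[of _ "cmod (c t)"] tendsto_norm)
        (simp add: isCont_def tendsto_nhds_iff)
    have "((\<lambda>t. cnj (c t) / (of_real e)\<^sup>2) has_vector_derivative cnj d / (of_real e)\<^sup>2) (at t)"
      by (intro bounded_linear.has_vector_derivative[OF bounded_linear_divide]
          bounded_linear.has_vector_derivative[OF bounded_linear_cnj] c)
    moreover have "\<forall>\<^sub>F s in nhds t. cnj (c s) / (of_real e)\<^sup>2 = reg_kernel e (c s)"
      using ev by eventually_elim (simp add: reg_kernel_inside)
    ultimately show ?thesis
      using True has_vector_derivative_transform_eventually by (simp add: reg_kernel_deriv_def)
  next
    case False
    with ne have gt: "e < cmod (c t)"
      by simp
    then have ev: "\<forall>\<^sub>F s in nhds t. e < cmod (c s)"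
      using cont by (intro order_tendstoD(1)[of _ "cmod (c t)"] tendsto_norm)
        (simp add: isCont_def tendsto_nhds_iff)
    have nz: "c t \<noteq> 0"
      using gt assms(1) by auto
    have "((\<lambda>z. inverse z) has_field_derivative - (1 / (c t)\<^sup>2)) (at (c t))"
      using nz by (auto intro!: derivative_eq_intros simp: power2_eq_square divide_simps)
    from field_vector_diff_chain_at[OF c this]
    have "((\<lambda>t. inverse (c t)) has_vector_derivative - d / (c t)\<^sup>2) (at t)"
      by (simp add: o_def)
    moreover have "\<forall>\<^sub>F s in nhds t. inverse (c s) = reg_kernel e (c s)"
      using ev by eventually_elim (use assms(1) in \<open>simp add: reg_kernel_outside\<close>)
    ultimately show ?thesis
      using gt has_vector_derivative_transform_eventually by (simp add: reg_kernel_deriv_def)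
  qed
qed

lemma norm_reg_kernel_deriv_le:
  assumes "0 < e"
  shows "cmod (reg_kernel_deriv e d z) \<le> cmod d / e\<^sup>2"
proof (cases "cmod z < e")
  case False
  then have "e\<^sup>2 \<le> (cmod z)\<^sup>2"
    using assms by (simp add: power_mono)
  then show ?thesis
    using False assms by (simp add: reg_kernel_deriv_def norm_divide norm_power frac_le)
qed (simp add: reg_kernel_deriv_def norm_divide norm_power)

text \<open>Outside the disc the kernel is holomorphic; inside, \<open>cnj\<close> contributes
  \<open>1 + \<i> * cnj \<i> = 2\<close>. Over the disc of area \<open>pi * e\<^sup>2\<close> this
  has total mass \<open>2 * pi\<close> for every \<open>e\<close>, so it acts as an approximate
  point mass.\<close>

lemma reg_kernel_deriv_cauchy_riemann:
  "reg_kernel_deriv e 1 z + \<i> * reg_kernel_deriv e \<i> z = (if cmod z < e then 2 / (of_real e)\<^sup>2 else 0)"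
  by (simp add: reg_kernel_deriv_def)

lemma norm_to_complex [simp]: "cmod (to_complex p) = norm p"
  by (simp add: to_complex_def cmod_def norm_prod_def)

lemma to_complex_diff: "to_complex (p - q) = to_complex p - to_complex q"
  by (simp add: to_complex_def complex_eq_iff)

lemma continuous_on_to_complex [continuous_intros]:
  "continuous_on S f \<Longrightarrow> continuous_on S (\<lambda>x. to_complex (f x))"
  unfolding to_complex_def Complex_eq by (intro continuous_intros)

lemma measurable_to_complex [measurable]: "to_complex \<in> borel_measurable borel"
  by (intro borel_measurable_continuous_onI continuous_intros)

lemma measurable_reg_kernel_deriv [measurable]: "reg_kernel_deriv e d \<in> borel_measurable borel"
  unfolding reg_kernel_deriv_def by measurable

lemma finite_square_eq: "finite {t::real. t\<^sup>2 = a}"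
proof -
  have "{t::real. t\<^sup>2 = a} \<subseteq> {sqrt a, - sqrt a}"
    by auto
  then show ?thesis
    by (rule finite_subset) auto
qed

lemma finite_norm_to_complex_eq:
  "finite {x. norm (x::real, y::real) = e}" "finite {y. norm (x::real, y::real) = e}"
proof -
  show "finite {x::real. norm (x, y) = e}"
    by (rule finite_subset[OF _ finite_square_eq[of "e\<^sup>2 - y\<^sup>2"]]) (auto simp: norm_prod_def)
  show "finite {y::real. norm (x, y) = e}"
    by (rule finite_subset[OF _ finite_square_eq[of "e\<^sup>2 - x\<^sup>2"]]) (auto simp: norm_prod_def)
qed

section \<open>The Cauchy-Pompeiu formula\<close>

locale compactly_supported_C1 =
  fixes g gx gy :: "real \<times> real \<Rightarrow> complex" and R :: real
  assumes deriv_x: "((\<lambda>x. g (x, y)) has_vector_derivative gx (x, y)) (at x)"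
    and deriv_y: "((\<lambda>y. g (x, y)) has_vector_derivative gy (x, y)) (at y)"
    and cont: "continuous_on UNIV g" "continuous_on UNIV gx" "continuous_on UNIV gy"
    and supp: "R \<le> norm p \<Longrightarrow> g p = 0" "R \<le> norm p \<Longrightarrow> gx p = 0" "R \<le> norm p \<Longrightarrow> gy p = 0"
begin

lemma measurable_C1 [measurable]:
  "g \<in> borel_measurable borel" "gx \<in> borel_measurable borel" "gy \<in> borel_measurable borel"
  using cont by (auto intro: borel_measurable_continuous_onI)

lemma bounded_C1:
  obtains M where "\<And>p. cmod (g p) \<le> M" "\<And>p. cmod (gx p) \<le> M" "\<And>p. cmod (gy p) \<le> M" "0 \<le> M"
proof -
  have *: "\<exists>M\<ge>0. \<forall>p. cmod (f p) \<le> M"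
    if "continuous_on UNIV f" "\<And>p. R \<le> norm p \<Longrightarrow> f p = 0" for f :: "real \<times> real \<Rightarrow> complex"
  proof -
    have "compact (f ` cball 0 R)"
      by (intro compact_continuous_image compact_cball continuous_on_subset[OF that(1)]) auto
    then obtain M where M: "\<And>p. p \<in> cball 0 R \<Longrightarrow> cmod (f p) \<le> M"
      by (meson bounded_iff compact_imp_bounded imageI)
    have "cmod (f p) \<le> max M 0" for p
      using M[of p] that(2)[of p] by (cases "norm p \<le> R") auto
    then show ?thesis
      by (intro exI[of _ "max M 0"]) auto
  qed
  obtain M1 M2 M3 where M: "\<And>p. cmod (g p) \<le> M1" "\<And>p. cmod (gx p) \<le> M2" "\<And>p. cmod (gy p) \<le> M3"
    "M1 \<ge> 0" "M2 \<ge> 0" "M3 \<ge> 0"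
    using *[OF cont(1) supp(1)] *[OF cont(2) supp(2)] *[OF cont(3) supp(3)] by blast
  show thesis
  proof
    fix p
    show "cmod (g p) \<le> M1 + M2 + M3" "cmod (gx p) \<le> M1 + M2 + M3" "cmod (gy p) \<le> M1 + M2 + M3"
      using M(1)[of p] M(2)[of p] M(3)[of p] M(4-6) by linarith+
  qed (use M(4-6) in linarith)
qed

lemma integrable_if_bounded:
  fixes f :: "real \<times> real \<Rightarrow> complex"
  assumes "f \<in> borel_measurable borel" "\<And>p. cmod (f p) \<le> M" "\<And>p. R \<le> norm p \<Longrightarrow> f p = 0"
  shows "integrable lborel f"
proof (rule integrableI_bounded_set[where A = "ball 0 R" and B = M])
  show "emeasure lborel (ball (0 :: real \<times> real) R) < \<infinity>"
    by (rule emeasure_bounded_finite) simp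
qed (use assms in auto)

lemma norm_add_mult_le:
  fixes a b c d :: complex
  assumes "cmod a \<le> M" "cmod b \<le> M" "0 \<le> M" "cmod c \<le> K" "cmod d \<le> L"
  shows "cmod (a * c + b * d) \<le> M * K + M * L"
  using assms by (intro order_trans[OF norm_triangle_ineq] add_mono) (auto simp: norm_mult intro!: mult_mono)

text \<open>The integrand is the \<open>x\<close>-derivative of \<open>g\<close> times the
  regularised kernel. It integrates to zero along every horizontal line, and Fubini does the
  rest.\<close>

lemma integral_parts_x:
  assumes "0 < e"
  shows "(LINT p|lborel. gx p * reg_kernel e (to_complex p) + g p * reg_kernel_deriv e 1 (to_complex p)) = 0"
    and "integrable lborel (\<lambda>p. gx p * reg_kernel e (to_complex p) + g p * reg_kernel_deriv e 1 (to_complex p))"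
proof -
  let ?A = "\<lambda>p. gx p * reg_kernel e (to_complex p) + g p * reg_kernel_deriv e 1 (to_complex p)"
  obtain M where M: "\<And>p. cmod (g p) \<le> M" "\<And>p. cmod (gx p) \<le> M" "0 \<le> M"
    using bounded_C1 by metis
  have [measurable]: "reg_kernel e \<in> borel_measurable borel"
    by (intro borel_measurable_continuous_onI continuous_on_reg_kernel assms)
  show int: "integrable lborel ?A"
  proof (rule integrable_if_bounded)
    show "?A \<in> borel_measurable borel"
      by measurable
    show "cmod (?A p) \<le> M * inverse e + M * (cmod 1 / e\<^sup>2)" for p
      by (intro norm_add_mult_le M norm_reg_kernel_le norm_reg_kernel_deriv_le assms)
  qed (simp add: supp)
  have "(LINT x|lborel. ?A (x, y)) = 0" for y
  proof (rule lborel_integral_derivative_zero)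
    show "finite {x::real. norm (x, y) = e}"
      by (rule finite_norm_to_complex_eq)
    show "((\<lambda>x. g (x, y) * reg_kernel e (to_complex (x, y))) has_vector_derivative ?A (x, y)) (at x)"
      if "x \<notin> {x. norm (x, y) = e}" for x
    proof -
      have "((\<lambda>x. to_complex (x, y)) has_vector_derivative 1) (at x)"
        unfolding to_complex_def Complex_eq
        by (auto intro!: derivative_eq_intros simp: has_vector_derivative_def scaleR_conv_of_real)
      from has_vector_derivative_mult[OF deriv_x has_vector_derivative_reg_kernel[OF assms this]] that
      show ?thesis
        by (simp add: algebra_simps)
    qed
    show "continuous_on UNIV (\<lambda>x. g (x, y) * reg_kernel e (to_complex (x, y)))"
      by (intro continuous_intros continuous_on_compose2[OF cont(1)]
          continuous_on_compose2[OF continuous_on_reg_kernel[OF assms]]) auto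
    fix x assume "R \<le> \<bar>x\<bar>"
    then have "R \<le> norm (x, y)"
      using norm_fst_le[of x y] by simp
    then show "g (x, y) * reg_kernel e (to_complex (x, y)) = 0 \<and> ?A (x, y) = 0"
      by (simp add: supp)
  qed
  then show "(LINT p|lborel. ?A p) = 0"
    using lborel_integral_iterated(2)[OF int] by simp
qed

lemma integral_parts_y:
  assumes "0 < e"
  shows "(LINT p|lborel. gy p * reg_kernel e (to_complex p) + g p * reg_kernel_deriv e \<i> (to_complex p)) = 0"
    and "integrable lborel (\<lambda>p. gy p * reg_kernel e (to_complex p) + g p * reg_kernel_deriv e \<i> (to_complex p))"
proof -
  let ?A = "\<lambda>p. gy p * reg_kernel e (to_complex p) + g p * reg_kernel_deriv e \<i> (to_complex p)"
  obtain M where M: "\<And>p. cmod (g p) \<le> M" "\<And>p. cmod (gy p) \<le> M" "0 \<le> M"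
    using bounded_C1 by metis
  have [measurable]: "reg_kernel e \<in> borel_measurable borel"
    by (intro borel_measurable_continuous_onI continuous_on_reg_kernel assms)
  show int: "integrable lborel ?A"
  proof (rule integrable_if_bounded)
    show "?A \<in> borel_measurable borel"
      by measurable
    show "cmod (?A p) \<le> M * inverse e + M * (cmod \<i> / e\<^sup>2)" for p
      by (intro norm_add_mult_le M norm_reg_kernel_le norm_reg_kernel_deriv_le assms)
  qed (simp add: supp)
  have "(LINT y|lborel. ?A (x, y)) = 0" for x
  proof (rule lborel_integral_derivative_zero)
    show "finite {y::real. norm (x, y) = e}"
      by (rule finite_norm_to_complex_eq)
    show "((\<lambda>y. g (x, y) * reg_kernel e (to_complex (x, y))) has_vector_derivative ?A (x, y)) (at y)"
      if "y \<notin> {y. norm (x, y) = e}" for y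
    proof -
      have "((\<lambda>y. to_complex (x, y)) has_vector_derivative \<i>) (at y)"
        unfolding to_complex_def Complex_eq
        by (auto intro!: derivative_eq_intros simp: has_vector_derivative_def scaleR_conv_of_real)
      from has_vector_derivative_mult[OF deriv_y has_vector_derivative_reg_kernel[OF assms this]] that
      show ?thesis
        by (simp add: algebra_simps)
    qed
    show "continuous_on UNIV (\<lambda>y. g (x, y) * reg_kernel e (to_complex (x, y)))"
      by (intro continuous_intros continuous_on_compose2[OF cont(1)]
          continuous_on_compose2[OF continuous_on_reg_kernel[OF assms]]) auto
    fix y assume "R \<le> \<bar>y\<bar>"
    then have "R \<le> norm (x, y)"
      using norm_snd_le[of y x] by simp
    then show "g (x, y) * reg_kernel e (to_complex (x, y)) = 0 \<and> ?A (x, y) = 0"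
      by (simp add: supp)
  qed
  then show "(LINT p|lborel. ?A p) = 0"
    using lborel_integral_iterated(1)[OF int] by simp
qed

text \<open>Adding \<open>\<i>\<close> times the vertical integration by parts to the horizontal one
  leaves \<open>g\<close> multiplied by the Cauchy-Riemann expression of the kernel, which is
  concentrated on the disc.\<close>

lemma pompeiu_regularised:
  assumes "0 < e"
  shows "(LINT p|lborel. (gx p + \<i> * gy p) * reg_kernel e (to_complex p))
       = - (2 / e\<^sup>2) *\<^sub>R (LINT p|lborel. indicator (ball 0 e) p *\<^sub>R g p)"
proof -
  let ?k = "\<lambda>p. reg_kernel e (to_complex p)" and ?d = "\<lambda>v p. reg_kernel_deriv e v (to_complex p)"
  have int: "integrable lborel (\<lambda>p. indicator (ball 0 e) p *\<^sub>R g p)"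
  proof -
    obtain M where "\<And>p. cmod (g p) \<le> M" "0 \<le> M"
      using bounded_C1 by metis
    then show ?thesis
      by (intro integrable_if_bounded[where M = M] borel_measurable_scaleR borel_measurable_indicator)
        (auto simp: supp indicator_def)
  qed
  have "(LINT p|lborel. (gx p + \<i> * gy p) * ?k p)
      = (LINT p|lborel. (gx p * ?k p + g p * ?d 1 p) + \<i> * (gy p * ?k p + g p * ?d \<i> p)
           - (2 / e\<^sup>2) *\<^sub>R (indicator (ball 0 e) p *\<^sub>R g p))"
  proof (rule Bochner_Integration.integral_cong[OF refl])
    fix p
    have *: "?d 1 p + \<i> * ?d \<i> p = of_real (2 / e\<^sup>2 * indicator (ball 0 e) p)"
      by (simp add: reg_kernel_deriv_cauchy_riemann indicator_def)
    have "(gx p * ?k p + g p * ?d 1 p) + \<i> * (gy p * ?k p + g p * ?d \<i> p)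
        = (gx p + \<i> * gy p) * ?k p + g p * (?d 1 p + \<i> * ?d \<i> p)"
      by (simp add: algebra_simps)
    then show "(gx p + \<i> * gy p) * ?k p = (gx p * ?k p + g p * ?d 1 p) + \<i> * (gy p * ?k p + g p * ?d \<i> p)
           - (2 / e\<^sup>2) *\<^sub>R (indicator (ball 0 e) p *\<^sub>R g p)"
      unfolding * by (simp add: scaleR_conv_of_real)
  qed
  also have "\<dots> = - (2 / e\<^sup>2) *\<^sub>R (LINT p|lborel. indicator (ball 0 e) p *\<^sub>R g p)"
    using int integral_parts_x[OF assms] integral_parts_y[OF assms]
    by (simp del: scaleR_scaleR)
  finally show ?thesis .
qed

end

lemma to_complex_eq_iff [simp]: "to_complex p = to_complex q \<longleftrightarrow> p = q"
  by (auto simp: to_complex_def prod_eq_iff)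

lemma lborel_integral_translate:
  fixes F :: "'a::euclidean_space \<Rightarrow> 'b::{banach, second_countable_topology}"
  assumes "F \<in> borel_measurable borel"
  shows "(LINT p|lborel. F (z + p)) = (LINT p|lborel. F p)"
    and "integrable lborel (\<lambda>p. F (z + p)) \<longleftrightarrow> integrable lborel F"
proof -
  have *: "(+) z \<in> lborel \<rightarrow>\<^sub>M borel"
    by simp
  show "(LINT p|lborel. F (z + p)) = (LINT p|lborel. F p)"
    using integral_distr[OF * assms] by (simp add: lborel_distr_plus)
  show "integrable lborel (\<lambda>p. F (z + p)) \<longleftrightarrow> integrable lborel F"
    using integrable_distr_eq[OF * assms] by (simp add: lborel_distr_plus)
qed

lemma disc_average_tendsto:
  fixes g :: "real \<times> real \<Rightarrow> complex"
  assumes cont: "continuous_on UNIV g"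
  shows "((\<lambda>e. (1 / e\<^sup>2) *\<^sub>R (LINT p|lborel. indicator (ball 0 e) p *\<^sub>R g p)) \<longlongrightarrow> pi *\<^sub>R g 0) (at_right 0)"
proof (rule tendstoI)
  fix \<eta> :: real assume "0 < \<eta>"
  \<comment> \<open>Scaled by \<open>1 / e\<^sup>2\<close>, the disc has area \<open>pi\<close>, so
    a pointwise error of \<open>\<eta> / (2 * pi)\<close> becomes \<open>\<eta> / 2\<close>.\<close>
  then have \<eta>: "0 < \<eta> / (2 * pi)"
    by simp
  have "isCont g 0"
    using cont continuous_on_eq_continuous_at by blast
  then obtain d where d: "d > 0" "\<And>p. norm p < d \<Longrightarrow> cmod (g p - g 0) < \<eta> / (2 * pi)"
    using \<eta> unfolding continuous_at_eps_delta dist_norm by (metis diff_zero)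
  have "dist ((1 / e\<^sup>2) *\<^sub>R (LINT p|lborel. indicator (ball 0 e) p *\<^sub>R g p)) (pi *\<^sub>R g 0) < \<eta>"
    if e: "0 < e" "e < d" for e
  proof -
    let ?B = "ball (0 :: real \<times> real) e"
    have fin: "emeasure lborel ?B < \<infinity>"
      by (rule emeasure_bounded_finite) simp
    have vol: "measure lborel ?B = pi * e\<^sup>2"
      using e content_ball[of e "0 :: real \<times> real"] by (simp add: unit_ball_vol_2 power2_eq_square)
    have [measurable]: "g \<in> borel_measurable borel"
      by (intro borel_measurable_continuous_onI cont)
    have i1: "integrable lborel (\<lambda>p. indicator ?B p *\<^sub>R (g p - g 0))"
      using e d(2) fin
      by (intro integrableI_bounded_set_indicator[where B = "\<eta> / (2 * pi)"]) (auto intro!: less_imp_le)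
    have i2: "integrable lborel (\<lambda>p. indicator ?B p *\<^sub>R g 0)"
      using fin by (intro integrable_indicator) auto
    have "(LINT p|lborel. indicator ?B p *\<^sub>R g p)
        = (LINT p|lborel. indicator ?B p *\<^sub>R (g p - g 0) + indicator ?B p *\<^sub>R g 0)"
      by (simp add: scaleR_diff_right)
    also have "\<dots> = (LINT p|lborel. indicator ?B p *\<^sub>R (g p - g 0)) + (pi * e\<^sup>2) *\<^sub>R g 0"
      using i1 i2 fin vol by simp
    finally have "(1 / e\<^sup>2) *\<^sub>R (LINT p|lborel. indicator ?B p *\<^sub>R g p) - pi *\<^sub>R g 0
        = (1 / e\<^sup>2) *\<^sub>R (LINT p|lborel. indicator ?B p *\<^sub>R (g p - g 0))"
      using e by (simp add: scaleR_add_right)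
    moreover have "cmod (LINT p|lborel. indicator ?B p *\<^sub>R (g p - g 0)) \<le> (LINT p|lborel. indicator ?B p *\<^sub>R (\<eta> / (2 * pi)))"
    proof (rule Bochner_Integration.integral_norm_bound_integral[OF i1])
      show "integrable lborel (\<lambda>p. indicator ?B p *\<^sub>R (\<eta> / (2 * pi)))"
        using fin by (intro integrable_indicator) auto
    qed (use e d(2) in \<open>auto simp: indicator_def intro: less_imp_le\<close>)
    moreover have "(LINT p|lborel. indicator ?B p *\<^sub>R (\<eta> / (2 * pi))) = (\<eta> / 2) * e\<^sup>2"
      using fin vol by simp
    ultimately have "dist ((1 / e\<^sup>2) *\<^sub>R (LINT p|lborel. indicator ?B p *\<^sub>R g p)) (pi *\<^sub>R g 0) \<le> (1 / e\<^sup>2) * ((\<eta> / 2) * e\<^sup>2)"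
      unfolding dist_norm by (simp only: norm_scaleR) (intro mult_mono, auto)
    also have "\<dots> < \<eta>"
      using e \<open>0 < \<eta>\<close> by simp
    finally show ?thesis .
  qed
  then show "\<forall>\<^sub>F e in at_right 0. dist ((1 / e\<^sup>2) *\<^sub>R (LINT p|lborel. indicator (ball 0 e) p *\<^sub>R g p)) (pi *\<^sub>R g 0) < \<eta>"
    using d(1) by (auto simp: eventually_at_right_field)
qed

context compactly_supported_C1
begin

text \<open>The limit of the regularised identity along \<open>e = 1 / (n + 1)\<close>. Away from
  the origin the kernels are eventually equal to \<open>1 / z\<close>; all integrands are dominated
  by \<open>2 * M / norm p\<close> on the support, which is integrable in the plane.\<close>

lemma pompeiu_origin: "(LINT p|lborel. (gx p + \<i> * gy p) / to_complex p) = - (2 * pi) *\<^sub>R g 0"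
proof -
  obtain M where M: "\<And>p. cmod (gx p) \<le> M" "\<And>p. cmod (gy p) \<le> M" "0 \<le> M"
    using bounded_C1 by metis
  let ?e = "\<lambda>n. inverse (real (Suc n))"
  let ?s = "\<lambda>n p. (gx p + \<i> * gy p) * reg_kernel (?e n) (to_complex p)"
  have e0: "?e \<longlonglongrightarrow> 0"
    by (rule LIMSEQ_inverse_real_of_nat)
  have "(\<lambda>n. LINT p|lborel. ?s n p) \<longlonglongrightarrow> (LINT p|lborel. (gx p + \<i> * gy p) / to_complex p)"
  proof (rule integral_dominated_convergence)
    show "(\<lambda>p. (gx p + \<i> * gy p) / to_complex p) \<in> borel_measurable lborel"
      by simp
    show "?s n \<in> borel_measurable lborel" for n
    proof -
      have [measurable]: "reg_kernel (?e n) \<in> borel_measurable borel"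
        by (intro borel_measurable_continuous_onI continuous_on_reg_kernel) simp
      show ?thesis unfolding measurable_lborel1 by measurable
    qed
    show "integrable lborel (\<lambda>p::real \<times> real. 2 * M * (indicator (ball 0 R) p *\<^sub>R inverse (norm p)))"
      by (intro integrable_mult_right integrable_inverse_norm_prod)
    show "AE p in lborel. (\<lambda>n. ?s n p) \<longlonglongrightarrow> (gx p + \<i> * gy p) / to_complex p"
      using AE_lborel_singleton[of "0 :: real \<times> real"]
    proof eventually_elim
      case (elim p)
      then have "\<forall>\<^sub>F n in sequentially. ?e n < norm p"
        using e0 by (intro order_tendstoD) auto
      then have "\<forall>\<^sub>F n in sequentially. ?s n p = (gx p + \<i> * gy p) / to_complex p"
        by eventually_elim (simp add: reg_kernel_outside divide_inverse)
      then show ?case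
        by (rule tendsto_eventually)
    qed
    show "AE p in lborel. cmod (?s n p) \<le> 2 * M * (indicator (ball 0 R) p *\<^sub>R inverse (norm p))" for n
    proof (rule AE_I2)
      fix p
      show "cmod (?s n p) \<le> 2 * M * (indicator (ball 0 R) p *\<^sub>R inverse (norm p))"
      proof (cases "norm p < R")
        case True
        have "cmod (gx p + \<i> * gy p) \<le> 2 * M"
          using M(1,2)[of p] norm_triangle_ineq[of "gx p" "\<i> * gy p"] by (simp add: norm_mult)
        then show ?thesis
          using True M(3) norm_reg_kernel_le_inverse_norm[of "?e n" "to_complex p"]
          by (simp add: norm_mult) (intro mult_mono, auto)
      qed (simp add: supp)
    qed
  qed
  moreover have "(\<lambda>n. LINT p|lborel. ?s n p) \<longlonglongrightarrow> - 2 *\<^sub>R (pi *\<^sub>R g 0)"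
  proof -
    have "filterlim ?e (at_right 0) sequentially"
      using e0 by (auto simp: filterlim_at)
    from filterlim_compose[OF disc_average_tendsto[OF cont(1)] this]
    have "(\<lambda>n. - 2 *\<^sub>R ((1 / (?e n)\<^sup>2) *\<^sub>R (LINT p|lborel. indicator (ball 0 (?e n)) p *\<^sub>R g p))) \<longlonglongrightarrow> - 2 *\<^sub>R (pi *\<^sub>R g 0)"
      by (rule tendsto_scaleR[OF tendsto_const])
    moreover have "(LINT p|lborel. ?s n p) = - 2 *\<^sub>R ((1 / (?e n)\<^sup>2) *\<^sub>R (LINT p|lborel. indicator (ball 0 (?e n)) p *\<^sub>R g p))" for n
      by (subst pompeiu_regularised) simp_all
    ultimately show ?thesis
      by simp
  qed
  ultimately show ?thesis
    using LIMSEQ_unique by fastforce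
qed

lemma translate:
  "compactly_supported_C1 (\<lambda>p. g (z + p)) (\<lambda>p. gx (z + p)) (\<lambda>p. gy (z + p)) (R + norm z)"
proof
  obtain a b where z: "z = (a, b)"
    by (cases z)
  fix x y :: real
  have sh: "((\<lambda>t::real. c + t) has_vector_derivative 1) (at t)" for c t
    by (auto intro!: derivative_eq_intros simp: has_vector_derivative_def)
  show "((\<lambda>x. g (z + (x, y))) has_vector_derivative gx (z + (x, y))) (at x)"
    using vector_diff_chain_at[OF sh[of a x] deriv_x[of "b + y" "a + x"]] by (simp add: z o_def)
  show "((\<lambda>y. g (z + (x, y))) has_vector_derivative gy (z + (x, y))) (at y)"
    using vector_diff_chain_at[OF sh[of b y] deriv_y[of "a + x" "b + y"]] by (simp add: z o_def)
next
  show "continuous_on UNIV (\<lambda>p. g (z + p))" "continuous_on UNIV (\<lambda>p. gx (z + p))"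
    "continuous_on UNIV (\<lambda>p. gy (z + p))"
    by (intro continuous_on_compose2[OF cont(1)] continuous_on_compose2[OF cont(2)]
        continuous_on_compose2[OF cont(3)] continuous_intros; simp)+
  fix p :: "real \<times> real" assume "R + norm z \<le> norm p"
  then have "R \<le> norm (z + p)"
    using norm_triangle_ineq2[of p "- z"] by (simp add: add.commute)
  then show "g (z + p) = 0" "gx (z + p) = 0" "gy (z + p) = 0"
    by (simp_all add: supp)
qed

lemma pompeiu: "(LINT p|lborel. (gx p + \<i> * gy p) / (to_complex p - to_complex z)) = - (2 * pi) *\<^sub>R g z"
proof -
  have "(LINT p|lborel. (gx p + \<i> * gy p) / (to_complex p - to_complex z))
      = (LINT p|lborel. (gx (z + p) + \<i> * gy (z + p)) / (to_complex (z + p) - to_complex z))"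
    by (subst lborel_integral_translate(1)[symmetric, of _ z]) simp_all
  also have "\<dots> = - (2 * pi) *\<^sub>R g z"
    using compactly_supported_C1.pompeiu_origin[OF translate[of z]]
    by (simp flip: to_complex_diff)
  finally show ?thesis .
qed

text \<open>Prepares Fubini: with a single bound \<open>K\<close> for all poles \<open>z\<close> on
  the loop, the outer integral over the loop parameter converges. After translation by
  \<open>z\<close> the support lies in the ball of radius \<open>R + B\<close>, where one multiple
  of \<open>inverse (norm p)\<close> dominates.\<close>

lemma cauchy_kernel_integrable_uniformly:
  assumes "0 \<le> B"
  shows "\<exists>K. \<forall>z. norm z \<le> B \<longrightarrow> integrable lborel (\<lambda>p. (gx p + \<i> * gy p) / (to_complex p - to_complex z))
      \<and> (LINT p|lborel. cmod ((gx p + \<i> * gy p) / (to_complex p - to_complex z))) \<le> K"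
proof -
  obtain M where M: "\<And>p. cmod (gx p) \<le> M" "\<And>p. cmod (gy p) \<le> M" "0 \<le> M"
    using bounded_C1 by metis
  let ?h = "\<lambda>p::real \<times> real. 2 * M * (indicator (ball 0 (R + B)) p *\<^sub>R inverse (norm p))"
  have int_h: "integrable lborel ?h"
    by (intro integrable_mult_right integrable_inverse_norm_prod)
  show ?thesis
  proof (intro exI allI impI conjI)
    fix z :: "real \<times> real" assume z: "norm z \<le> B"
    let ?f = "\<lambda>p. (gx p + \<i> * gy p) / (to_complex p - to_complex z)"
    have meas: "?f \<in> borel_measurable borel"
      by simp
    have le: "cmod (?f (z + p)) \<le> ?h p" for p
    proof (cases "norm p < R + B")
      case True
      have "cmod (gx (z + p) + \<i> * gy (z + p)) \<le> 2 * M"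
        using M(1,2)[of "z + p"] norm_triangle_ineq[of "gx (z + p)" "\<i> * gy (z + p)"] by (simp add: norm_mult)
      then show ?thesis
        using True by (simp add: divide_inverse norm_mult norm_inverse mult_right_mono flip: to_complex_diff)
    next
      case False
      then have "R \<le> norm (z + p)"
        using norm_triangle_ineq2[of p "- z"] z by (simp add: add.commute)
      then show ?thesis
        using False by (simp add: supp)
    qed
    have int: "integrable lborel (\<lambda>p. ?f (z + p))"
    proof (rule Bochner_Integration.integrable_bound[OF int_h])
      show "(\<lambda>p. ?f (z + p)) \<in> borel_measurable lborel"
        by simp
      show "AE p in lborel. cmod (?f (z + p)) \<le> norm (?h p)"
        using order_trans[OF le abs_ge_self] by (intro AE_I2) (simp only: real_norm_def)
    qed
    then show "integrable lborel ?f"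
      by (simp only: lborel_integral_translate(2)[OF meas])
    have "(LINT p|lborel. cmod (?f p)) = (LINT p|lborel. cmod (?f (z + p)))"
      by (subst lborel_integral_translate(1)[symmetric, of _ z]) simp_all
    also have "\<dots> \<le> (LINT p|lborel. ?h p)"
      by (intro integral_mono integrable_norm int int_h le)
    finally show "(LINT p|lborel. cmod (?f p)) \<le> (LINT p|lborel. ?h p)" .
  qed
qed

end

section \<open>Green's theorem with winding numbers\<close>

lemma winding_number_C1_loop:
  assumes der: "\<And>s. (\<gamma> has_vector_derivative \<gamma>' s) (at s)" and cont: "continuous_on UNIV \<gamma>'"
    and z: "z \<notin> \<gamma> ` {0..1}"
  shows "2 * pi * \<i> * winding_number \<gamma> z = integral {0..1} (\<lambda>s. \<gamma>' s / (\<gamma> s - z))"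
proof -
  have "\<gamma> C1_differentiable_on {0..1}"
    unfolding C1_differentiable_on_def using der continuous_on_subset[OF cont] by blast
  then have vp: "valid_path \<gamma>"
    by (simp add: valid_path_def C1_differentiable_imp_piecewise)
  have "2 * pi * \<i> * winding_number \<gamma> z = contour_integral \<gamma> (\<lambda>w. 1 / (w - z))"
    using z by (subst winding_number_valid_path[OF vp]) (auto simp: path_image_def)
  also have "\<dots> = integral {0..1} (\<lambda>s. \<gamma>' s / (\<gamma> s - z))"
    unfolding contour_integral_integral using vector_derivative_at[OF der] by simp
  finally show ?thesis .
qed

text \<open>A differentiable image of an interval has lower dimension than the plane and is
  negligible. Compactness makes it Borel, hence a null set of \<open>lborel\<close> itself and not
  only of its completion.\<close>

lemma AE_notin_C1_curve:
  fixes \<beta> :: "real \<Rightarrow> real \<times> real"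
  assumes der: "\<And>s. ((\<lambda>s. to_complex (\<beta> s)) has_vector_derivative b' s) (at s)"
  shows "AE p in lborel. p \<notin> \<beta> ` {a..b}"
proof -
  let ?\<gamma> = "\<lambda>s. to_complex (\<beta> s)"
  have "\<beta> = (\<lambda>s. (Re (?\<gamma> s), Im (?\<gamma> s)))"
    by (simp add: to_complex_def)
  moreover have "(\<lambda>s. (Re (?\<gamma> s), Im (?\<gamma> s))) differentiable (at s)" for s
  proof -
    have d: "(?\<gamma> has_derivative (\<lambda>x. x *\<^sub>R b' s)) (at s)"
      using der by (simp add: has_vector_derivative_def)
    have "((\<lambda>s. (Re (?\<gamma> s), Im (?\<gamma> s))) has_derivative (\<lambda>x. (Re (x *\<^sub>R b' s), Im (x *\<^sub>R b' s)))) (at s)"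
      by (intro has_derivative_Pair bounded_linear.has_derivative[OF bounded_linear_Re d]
          bounded_linear.has_derivative[OF bounded_linear_Im d])
    then show ?thesis
      unfolding differentiable_def by blast
  qed
  ultimately have diff: "\<beta> differentiable (at s)" for s
    by metis
  then have "\<beta> differentiable_on {a..b}"
    by (simp add: differentiable_at_imp_differentiable_on)
  then have "negligible (\<beta> ` {a..b})"
    by (intro negligible_differentiable_image_lowdim) auto
  then have "\<beta> ` {a..b} \<in> null_sets (completion lborel)"
    by (simp add: negligible_iff_null_sets)
  moreover have "compact (\<beta> ` {a..b})"
    using diff by (intro compact_continuous_image compact_Icc)
      (auto intro: continuous_at_imp_continuous_on differentiable_imp_continuous_within)
  then have "\<beta> ` {a..b} \<in> sets lborel"
    by (simp add: borel_compact)
  ultimately have "\<beta> ` {a..b} \<in> null_sets lborel"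
    by (simp add: null_sets_def)
  then show ?thesis
    by (rule AE_not_in)
qed

context compactly_supported_C1
begin

text \<open>\<open>W\<close> is a measurable stand-in for the winding number, prescribed off the
  curve only; the curve is a null set, so the area integral is determined. The factor
  \<open>\<i>\<close> is the product of \<open>- 1 / (2 * pi)\<close> from Pompeiu's formula and
  \<open>- 2 * pi * \<i>\<close> from the winding number.\<close>

lemma green_winding_number:
  fixes \<beta> :: "real \<Rightarrow> real \<times> real" and W :: "real \<times> real \<Rightarrow> complex"
  assumes der: "\<And>s. ((\<lambda>s. to_complex (\<beta> s)) has_vector_derivative b' s) (at s)"
    and contb: "continuous_on UNIV b'"
    and W: "W \<in> borel_measurable borel"
      "\<And>p. p \<notin> \<beta> ` {0..1} \<Longrightarrow> W p = winding_number (\<lambda>s. to_complex (\<beta> s)) (to_complex p)"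
  shows "integral {0..1} (\<lambda>s. g (\<beta> s) * b' s) = \<i> * (LINT p|lborel. (gx p + \<i> * gy p) * W p)"
proof -
  let ?G = "\<lambda>p. gx p + \<i> * gy p" and ?I = "indicator {0..1::real} :: real \<Rightarrow> real"
  let ?f = "\<lambda>s p. ?I s *\<^sub>R (b' s * (?G p / (to_complex p - to_complex (\<beta> s))))"
  have cont_b: "continuous_on UNIV (\<lambda>s. to_complex (\<beta> s))"
    using der by (auto intro: continuous_at_imp_continuous_on has_vector_derivative_continuous)
  have "continuous_on UNIV (\<lambda>s. (Re (to_complex (\<beta> s)), Im (to_complex (\<beta> s))))"
    by (intro continuous_intros cont_b)
  then have cont_beta: "continuous_on UNIV \<beta>"
    by (simp add: to_complex_def)
  have [measurable]: "\<beta> \<in> borel_measurable borel" "b' \<in> borel_measurable borel"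
    using cont_beta contb by (simp_all add: borel_measurable_continuous_onI)
  have bdd: "\<exists>B. \<forall>s\<in>{0..1}. norm (h s) \<le> B" if "continuous_on UNIV h" for h :: "real \<Rightarrow> 'a::real_normed_vector"
  proof -
    have "compact (h ` {0..1})"
      by (rule compact_continuous_image[OF continuous_on_subset[OF that subset_UNIV] compact_Icc])
    then show ?thesis
      using compact_imp_bounded by (fastforce simp: bounded_iff)
  qed
  obtain B where B: "\<And>s. s \<in> {0..1} \<Longrightarrow> norm (\<beta> s) \<le> B"
    using bdd[OF cont_beta] by blast
  obtain L where L: "\<And>s. s \<in> {0..1} \<Longrightarrow> cmod (b' s) \<le> L"
    using bdd[OF contb] by blast
  have "0 \<le> B" "0 \<le> L"
    using order_trans[OF norm_ge_zero B[of 0]] order_trans[OF norm_ge_zero L[of 0]] by auto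
  obtain K where K: "\<And>z. norm z \<le> B \<Longrightarrow> integrable lborel (\<lambda>p. ?G p / (to_complex p - to_complex z))"
    "\<And>z. norm z \<le> B \<Longrightarrow> (LINT p|lborel. cmod (?G p / (to_complex p - to_complex z))) \<le> K"
    using cauchy_kernel_integrable_uniformly[OF \<open>0 \<le> B\<close>] by blast
  have int: "integrable (lborel \<Otimes>\<^sub>M lborel) (case_prod ?f)"
  proof (rule lborel_pair.Fubini_integrable)
    show "case_prod ?f \<in> borel_measurable (lborel \<Otimes>\<^sub>M lborel)"
      by measurable
    show "integrable lborel (\<lambda>s. LINT p|lborel. norm (case (s, p) of (s, p) \<Rightarrow> ?f s p))"
    proof (rule integrableI_bounded_set[where A = "{0..1}" and B = "L * K"])
      have "norm (LINT p|lborel. norm (?f s p)) \<le> L * K" if s: "s \<in> {0..1}" for s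
      proof -
        have "(LINT p|lborel. norm (?f s p)) = cmod (b' s) * (LINT p|lborel. cmod (?G p / (to_complex p - to_complex (\<beta> s))))"
        proof -
          have "norm (?f s p) = cmod (b' s) * cmod (?G p / (to_complex p - to_complex (\<beta> s)))" for p
            using s by (simp add: norm_mult norm_divide)
          then show ?thesis
            by (simp only: integral_mult_right_zero)
        qed
        also have "\<dots> \<le> L * K"
          using L[OF s] K(2)[OF B[OF s]] \<open>0 \<le> L\<close> by (intro mult_mono integral_nonneg_AE) auto
        finally show ?thesis
          unfolding real_norm_def by (subst abs_of_nonneg[OF integral_nonneg_AE]) auto
      qed
      then show "AE s in lborel. s \<in> {0..1} \<longrightarrow>
          norm (LINT p|lborel. norm (case (s, p) of (s, p) \<Rightarrow> ?f s p)) \<le> L * K"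
        by simp
    qed auto
    show "AE s in lborel. integrable lborel (\<lambda>p. case (s, p) of (s, p) \<Rightarrow> ?f s p)"
    proof (rule AE_I2)
      show "integrable lborel (\<lambda>p. case (s, p) of (s, p) \<Rightarrow> ?f s p)" for s
        using integrable_mult_right[OF K(1)[OF B, of s], of "b' s"]
        by (cases "s \<in> {0..1}") (auto simp del: times_divide_eq_right)
    qed
  qed
  have "integral {0..1} (\<lambda>s. g (\<beta> s) * b' s) = (LINT s|lborel. ?I s *\<^sub>R (g (\<beta> s) * b' s))"
  proof -
    have "continuous_on {0..1} (\<lambda>s. g (\<beta> s) * b' s)"
      using cont_beta contb
      by (intro continuous_intros continuous_on_compose2[OF cont(1)]) (auto intro: continuous_on_subset)
    then have "set_integrable lborel {0..1} (\<lambda>s. g (\<beta> s) * b' s)"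
      by (rule borel_integrable_atLeastAtMost')
    from set_borel_integral_eq_integral(2)[OF this] show ?thesis
      by (simp only: set_lebesgue_integral_def)
  qed
  also have "\<dots> = - (1 / (2 * pi)) *\<^sub>R (LINT s|lborel. LINT p|lborel. ?f s p)"
  proof -
    have "?I s *\<^sub>R (g (\<beta> s) * b' s) = - (1 / (2 * pi)) *\<^sub>R (LINT p|lborel. ?f s p)" for s
    proof -
      have "(LINT p|lborel. ?f s p)
          = ?I s *\<^sub>R (b' s * (LINT p|lborel. ?G p / (to_complex p - to_complex (\<beta> s))))"
        by (simp only: integral_scaleR_right integral_mult_right_zero)
      then show ?thesis
        unfolding pompeiu[of "\<beta> s"] by (simp add: scaleR_conv_of_real)
    qed
    then show ?thesis
      by (simp only: integral_scaleR_right)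
  qed
  also have "(LINT s|lborel. LINT p|lborel. ?f s p) = (LINT p|lborel. LINT s|lborel. ?f s p)"
    using lborel_pair.Fubini_integral[OF int] by simp
  also have "\<dots> = (LINT p|lborel. - (2 * pi * \<i>) * (?G p * W p))"
  proof (rule integral_cong_AE)
    show "(\<lambda>p. LINT s|lborel. ?f s p) \<in> borel_measurable lborel"
      using lborel_pair.integrable_snd[OF int] by (rule borel_measurable_integrable)
    show "(\<lambda>p. - (2 * pi * \<i>) * (?G p * W p)) \<in> borel_measurable lborel"
      using W(1) by simp
    show "AE p in lborel. (LINT s|lborel. ?f s p) = - (2 * pi * \<i>) * (?G p * W p)"
      using AE_notin_C1_curve[OF der, of 0 1]
    proof eventually_elim
      case (elim p)
      let ?q = "\<lambda>s. b' s / (to_complex (\<beta> s) - to_complex p)"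
      have ne: "to_complex (\<beta> s) \<noteq> to_complex p" if "s \<in> {0..1}" for s
        using that elim by auto
      have "continuous_on {0..1} ?q"
        using ne by (intro continuous_intros continuous_on_subset[OF contb] continuous_on_subset[OF cont_beta]) auto
      then have "set_integrable lborel {0..1} ?q"
        by (rule borel_integrable_atLeastAtMost')
      from set_borel_integral_eq_integral(2)[OF this]
      have "(LINT s|lborel. ?I s *\<^sub>R ?q s) = integral {0..1} ?q"
        by (simp only: set_lebesgue_integral_def)
      also have "\<dots> = 2 * pi * \<i> * W p"
        using elim by (subst winding_number_C1_loop[OF der contb, symmetric]) (auto simp: W(2)[OF elim])
      finally have *: "(LINT s|lborel. ?I s *\<^sub>R ?q s) = 2 * pi * \<i> * W p" .
      \<comment> \<open>Pompeiu's kernel has the difference \<open>p - \<beta> s\<close> in the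
        denominator, the winding number \<open>\<beta> s - p\<close>; hence the sign. If the two
        points coincide, both sides are \<open>0\<close>, the value of a division by zero.\<close>
      have "?f s p = - ?G p * (?I s *\<^sub>R ?q s)" for s
        by (cases "to_complex (\<beta> s) = to_complex p") (auto simp: divide_simps scaleR_conv_of_real, auto simp: algebra_simps)
      then have "(LINT s|lborel. ?f s p) = - ?G p * (LINT s|lborel. ?I s *\<^sub>R ?q s)"
        by (simp only: integral_mult_right_zero)
      also have "\<dots> = - (2 * pi * \<i>) * (?G p * W p)"
      proof -
        have "- a * (c * w) = - c * (a * w)" for a c w :: complex
          by simp
        then show ?thesis
          unfolding * .
      qed
      finally show ?case .
    qed
  qed
  also have "\<dots> = - (2 * pi * \<i>) * (LINT p|lborel. ?G p * W p)"
    by (rule integral_mult_right_zero)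
  finally show ?thesis
    by (simp add: scaleR_conv_of_real)
qed

end

section \<open>Cutoff functions and Green's theorem on an enclosed region\<close>

text \<open>The building block of all bumps below: squaring smooths the kink of the positive part,
  because the difference quotient at \<open>0\<close> is bounded by
  \<open>\<bar>h\<bar>\<close>.\<close>

lemma DERIV_pos_part_square: "((\<lambda>x::real. (max 0 x)\<^sup>2) has_real_derivative 2 * max 0 x) (at x)"
proof -
  consider "x < 0" | "x = 0" | "x > 0"
    by linarith
  then show ?thesis
  proof cases
    case 1
    have "((\<lambda>x::real. 0) has_real_derivative 2 * max 0 x) (at x)"
      using 1 by (auto intro!: derivative_eq_intros)
    then show ?thesis
      by (rule DERIV_cong_ev[THEN iffD1, rotated 3])
        (use 1 in \<open>auto intro!: eventually_mono[OF eventually_nhds_in_open[of "{..<0}"]]\<close>)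
  next
    case 3
    have "((\<lambda>x::real. x\<^sup>2) has_real_derivative 2 * max 0 x) (at x)"
      using 3 by (auto intro!: derivative_eq_intros)
    then show ?thesis
      by (rule DERIV_cong_ev[THEN iffD1, rotated 3])
        (use 3 in \<open>auto intro!: eventually_mono[OF eventually_nhds_in_open[of "{0<..}"]]\<close>)
  next
    case 2
    have "((\<lambda>h. ((max 0 (0 + h))\<^sup>2 - (max 0 0)\<^sup>2) / h) \<longlongrightarrow> (0::real)) (at 0)"
    proof (rule Lim_null_comparison)
      show "((\<lambda>h::real. \<bar>h\<bar>) \<longlongrightarrow> 0) (at 0)"
        by (intro tendsto_rabs_zero tendsto_ident_at)
      show "\<forall>\<^sub>F h in at 0. norm (((max 0 (0 + h))\<^sup>2 - (max 0 0)\<^sup>2) / h) \<le> \<bar>h :: real\<bar>"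
        by (intro always_eventually allI) (auto simp: max_def power2_eq_square abs_if)
    qed
    then show ?thesis
      using 2 by (simp add: DERIV_def)
  qed
qed

text \<open>Finitely many balls with closure in \<open>V\<close> cover \<open>K\<close>. The sum
  \<open>\<sigma>\<close> of squared positive parts of \<open>d q\<close> is positive on each ball,
  so it has a positive minimum \<open>m\<close> on \<open>K\<close>; a \<open>C^1\<close> cap at the
  level \<open>m\<close> produces the plateau.\<close>

lemma C1_cutoff:
  fixes K V :: "(real \<times> real) set"
  assumes "compact K" "open V" "K \<subseteq> V"
  obtains \<psi> \<psi>x \<psi>y :: "real \<times> real \<Rightarrow> real" and S where
    "\<And>x y. ((\<lambda>x. \<psi> (x, y)) has_real_derivative \<psi>x (x, y)) (at x)"
    "\<And>x y. ((\<lambda>y. \<psi> (x, y)) has_real_derivative \<psi>y (x, y)) (at y)"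
    "continuous_on UNIV \<psi>" "continuous_on UNIV \<psi>x" "continuous_on UNIV \<psi>y"
    "compact S" "S \<subseteq> V" "\<And>p. p \<in> K \<Longrightarrow> \<psi> p = 1"
    "\<And>p. p \<notin> S \<Longrightarrow> \<psi> p = 0 \<and> \<psi>x p = 0 \<and> \<psi>y p = 0"
proof -
  have "\<forall>p\<in>K. \<exists>r>0. cball p r \<subseteq> V"
    using assms open_contains_cball by blast
  then obtain r where r: "\<And>p. p \<in> K \<Longrightarrow> r p > 0 \<and> cball p (r p) \<subseteq> V"
    by metis
  have "K \<subseteq> (\<Union>p\<in>K. ball p (r p))"
    using r by force
  then obtain F where F: "F \<subseteq> K" "finite F" "K \<subseteq> (\<Union>p\<in>F. ball p (r p))"
    by (rule compactE_image[OF \<open>compact K\<close> open_ball])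
  define d where "d q p = (r q)\<^sup>2 - ((fst p - fst q)\<^sup>2 + (snd p - snd q)\<^sup>2)" for q p :: "real \<times> real"
  have d_dist: "d q p = (r q)\<^sup>2 - (dist p q)\<^sup>2" for p q
    by (simp add: d_def dist_prod_def dist_real_def)
  define \<sigma> where "\<sigma> p = (\<Sum>q\<in>F. (max 0 (d q p))\<^sup>2)" for p
  define \<sigma>x where "\<sigma>x p = (\<Sum>q\<in>F. 2 * max 0 (d q p) * (- (2 * (fst p - fst q))))" for p
  define \<sigma>y where "\<sigma>y p = (\<Sum>q\<in>F. 2 * max 0 (d q p) * (- (2 * (snd p - snd q))))" for p
  have cont_d: "continuous_on UNIV (d q)" for q
    unfolding d_def by (intro continuous_intros)
  have cont: "continuous_on UNIV \<sigma>" "continuous_on UNIV \<sigma>x" "continuous_on UNIV \<sigma>y"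
    unfolding \<sigma>_def \<sigma>x_def \<sigma>y_def by (intro continuous_intros cont_d)+
  have sx: "((\<lambda>x. \<sigma> (x, y)) has_real_derivative \<sigma>x (x, y)) (at x)" for x y
    unfolding \<sigma>_def \<sigma>x_def
  proof (rule DERIV_sum)
    fix q
    have "((\<lambda>x. d q (x, y)) has_real_derivative - (2 * (fst (x, y) - fst q))) (at x)"
      unfolding d_def by (auto intro!: derivative_eq_intros)
    from DERIV_chain2[OF DERIV_pos_part_square this]
    show "((\<lambda>x. (max 0 (d q (x, y)))\<^sup>2) has_real_derivative
        2 * max 0 (d q (x, y)) * (- (2 * (fst (x, y) - fst q)))) (at x)" .
  qed
  have sy: "((\<lambda>y. \<sigma> (x, y)) has_real_derivative \<sigma>y (x, y)) (at y)" for x y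
    unfolding \<sigma>_def \<sigma>y_def
  proof (rule DERIV_sum)
    fix q
    have "((\<lambda>y. d q (x, y)) has_real_derivative - (2 * (snd (x, y) - snd q))) (at y)"
      unfolding d_def by (auto intro!: derivative_eq_intros)
    from DERIV_chain2[OF DERIV_pos_part_square this]
    show "((\<lambda>y. (max 0 (d q (x, y)))\<^sup>2) has_real_derivative
        2 * max 0 (d q (x, y)) * (- (2 * (snd (x, y) - snd q)))) (at y)" .
  qed
  have pos: "\<sigma> p > 0" if pK: "p \<in> K" for p
  proof -
    obtain q where "q \<in> F" "p \<in> ball q (r q)"
      using F(3) pK by blast
    then have q: "q \<in> F" "dist p q < r q"
      by (simp_all add: dist_commute)
    then have "d q p > 0"
      by (simp add: d_dist power_strict_mono)
    then show ?thesis
      unfolding \<sigma>_def using q(1) F(2) by (intro sum_pos2[of F q]) auto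
  qed
  obtain m where m: "m > 0" "\<And>p. p \<in> K \<Longrightarrow> m \<le> \<sigma> p"
  proof (cases "K = {}")
    case False
    then obtain p0 where "p0 \<in> K" "\<And>p. p \<in> K \<Longrightarrow> \<sigma> p0 \<le> \<sigma> p"
      using continuous_attains_inf[OF \<open>compact K\<close> False continuous_on_subset[OF cont(1)]] by blast
    then show ?thesis
      using that pos by blast
  qed (use that[of 1] in auto)
  \<comment> \<open>As a function of \<open>t = \<sigma> p / m\<close>, the expression
    \<open>1 - (max 0 (1 - t))\<^sup>2\<close> is \<open>C^1\<close>, vanishes at
    \<open>t = 0\<close> and is constantly \<open>1\<close> from \<open>t = 1\<close> on.\<close>
  define \<psi> where "\<psi> p = 1 - (max 0 (1 - \<sigma> p / m))\<^sup>2" for p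
  define \<psi>x where "\<psi>x p = - (2 * max 0 (1 - \<sigma> p / m) * (- (\<sigma>x p / m)))" for p
  define \<psi>y where "\<psi>y p = - (2 * max 0 (1 - \<sigma> p / m) * (- (\<sigma>y p / m)))" for p
  define S where "S = (\<Union>p\<in>F. cball p (r p))"
  show thesis
  proof
    fix x y
    have "((\<lambda>x. 1 - \<sigma> (x, y) / m) has_real_derivative - (\<sigma>x (x, y) / m)) (at x)"
      using m(1) by (auto intro!: derivative_eq_intros sx)
    from DERIV_diff[OF DERIV_const DERIV_chain2[OF DERIV_pos_part_square this]]
    show "((\<lambda>x. \<psi> (x, y)) has_real_derivative \<psi>x (x, y)) (at x)"
      unfolding \<psi>_def \<psi>x_def by (rule DERIV_cong) simp
    have "((\<lambda>y. 1 - \<sigma> (x, y) / m) has_real_derivative - (\<sigma>y (x, y) / m)) (at y)"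
      using m(1) by (auto intro!: derivative_eq_intros sy)
    from DERIV_diff[OF DERIV_const DERIV_chain2[OF DERIV_pos_part_square this]]
    show "((\<lambda>y. \<psi> (x, y)) has_real_derivative \<psi>y (x, y)) (at y)"
      unfolding \<psi>_def \<psi>y_def by (rule DERIV_cong) simp
  next
    show "continuous_on UNIV \<psi>" "continuous_on UNIV \<psi>x" "continuous_on UNIV \<psi>y"
      unfolding \<psi>_def \<psi>x_def \<psi>y_def using m(1) by (intro continuous_intros cont; simp)+
    show "compact S"
      unfolding S_def using F(2) by (intro compact_UN) auto
    show "S \<subseteq> V"
      unfolding S_def using F(1) r by blast
  next
    fix p assume "p \<in> K"
    then show "\<psi> p = 1"
      using m(1) m(2)[of p] unfolding \<psi>_def by (simp add: max_def)
  next
    fix p assume p: "p \<notin> S"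
    have "d q p \<le> 0" if "q \<in> F" for q
    proof -
      have "r q \<le> dist p q"
        using p that by (auto simp: S_def dist_commute)
      moreover have "0 < r q"
        using r that F(1) by blast
      ultimately show ?thesis
        by (simp add: d_dist power_mono)
    qed
    then have "\<sigma> p = 0" "\<sigma>x p = 0" "\<sigma>y p = 0"
      unfolding \<sigma>_def \<sigma>x_def \<sigma>y_def by (auto intro!: sum.neutral simp: max_absorb1)
    then show "\<psi> p = 0 \<and> \<psi>x p = 0 \<and> \<psi>y p = 0"
      by (simp add: \<psi>_def \<psi>x_def \<psi>y_def)
  qed
qed

text \<open>The open sets \<open>V\<close> and \<open>- S\<close> cover the space because
  \<open>S\<close> lies in \<open>V\<close>; on each of them \<open>h\<close> agrees with a
  continuous function.\<close>

lemma continuous_on_extend_by_zero: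
  fixes f h :: "'a::t2_space \<Rightarrow> 'b::topological_space"
  assumes "compact S" "open V" "S \<subseteq> V" and f: "continuous_on V f" and eq: "\<And>p. p \<in> V \<Longrightarrow> h p = f p"
    and off: "\<And>p. p \<notin> S \<Longrightarrow> h p = c"
  shows "continuous_on UNIV h"
proof -
  have "continuous_on (V \<union> - S) h"
  proof (rule continuous_on_open_Un)
    show "open (- S)"
      using assms(1) compact_imp_closed by blast
    show "continuous_on V h"
      using f eq by (metis continuous_on_cong)
    show "continuous_on (- S) h"
      using off by (metis ComplD continuous_on_cong continuous_on_const)
  qed fact
  then show ?thesis
    using assms(3) by (metis Compl_partition sup.orderE sup_mono order_refl top.extremum_unique)
qed

lemma continuous_on_mult_cutoff:
  fixes \<psi> :: "real \<times> real \<Rightarrow> real" and f :: "real \<times> real \<Rightarrow> complex"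
  assumes "compact S" "open V" "S \<subseteq> V" "continuous_on V f" "continuous_on UNIV \<psi>" "\<And>p. p \<notin> S \<Longrightarrow> \<psi> p = 0"
  shows "continuous_on UNIV (\<lambda>p. of_real (\<psi> p) * (if p \<in> V then f p else 0))"
  by (rule continuous_on_extend_by_zero[OF assms(1-3), where f = "\<lambda>p. of_real (\<psi> p) * f p" and c = 0])
    (use assms in \<open>auto intro!: continuous_intros intro: continuous_on_subset\<close>)

lemma has_vector_derivative_zero_off:
  fixes h :: "real \<Rightarrow> 'a::real_normed_vector"
  assumes "open A" "c -` A = B" "continuous_on UNIV c" "t \<in> B" "\<And>s. s \<in> B \<Longrightarrow> h s = 0"
  shows "(h has_vector_derivative 0) (at t)"
proof -
  have "open B"
    using assms(1-3) by (metis continuous_on_open_vimage open_UNIV inf_top_right)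
  then show ?thesis
    by (rule has_vector_derivative_transform_within_open[OF has_vector_derivative_const[of 0] _ assms(4)])
      (simp add: assms(5))
qed

lemma absolutely_integrable_on_subset_compact:
  fixes f :: "'a::euclidean_space \<Rightarrow> 'b::euclidean_space"
  assumes "compact K" "continuous_on K f" "A \<in> sets borel" "A \<subseteq> K"
  shows "f absolutely_integrable_on A"
proof -
  have "set_integrable lborel K f"
    unfolding set_integrable_def by (rule borel_integrable_compact[OF assms(1,2)])
  then have "set_integrable lborel A f"
    by (rule set_integrable_subset) (use assms in auto)
  then show ?thesis
    unfolding set_integrable_def by (subst integrable_completion) (auto intro: borel_measurable_integrable)
qed

lemma open_sections:
  assumes "open (V :: ('a::topological_space \<times> 'b::topological_space) set)"
  shows "open {x. (x, y) \<in> V}" "open {y. (x, y) \<in> V}"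
  using open_vimage[OF assms, of "\<lambda>x. (x, y)"] open_vimage[OF assms, of "\<lambda>y. (x, y)"]
  by (simp_all add: vimage_def continuous_intros)

text \<open>Multiplying by a cutoff that is \<open>1\<close> on \<open>K\<close> changes neither
  \<open>g\<close> on the curve nor, as \<open>\<Omega>\<close> is open in the plateau, its
  derivatives on \<open>\<Omega>\<close>. The cut-off function is defined on the whole plane, and
  \<open>w\<close> times the indicator of \<open>\<Omega>\<close> is the measurable winding
  number.\<close>

theorem green_enclosed_region:
  fixes g gx gy :: "real \<times> real \<Rightarrow> complex" and V K \<Omega> :: "(real \<times> real) set" and w :: complex
  assumes "compact K" "open V" "K \<subseteq> V" "open \<Omega>" "\<Omega> \<subseteq> K"
    and gx: "\<And>x y. (x, y) \<in> V \<Longrightarrow> ((\<lambda>x. g (x, y)) has_vector_derivative gx (x, y)) (at x)"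
    and gy: "\<And>x y. (x, y) \<in> V \<Longrightarrow> ((\<lambda>y. g (x, y)) has_vector_derivative gy (x, y)) (at y)"
    and cont: "continuous_on V g" "continuous_on V gx" "continuous_on V gy"
    and der: "\<And>s. ((\<lambda>s. to_complex (\<beta> s)) has_vector_derivative b' s) (at s)"
    and contb: "continuous_on UNIV b'"
    and \<beta>: "\<beta> ` {0..1} \<subseteq> K - \<Omega>"
    and w: "\<And>p. p \<in> \<Omega> \<Longrightarrow> winding_number (\<lambda>s. to_complex (\<beta> s)) (to_complex p) = w"
      "\<And>p. p \<notin> \<Omega> \<Longrightarrow> p \<notin> \<beta> ` {0..1} \<Longrightarrow> winding_number (\<lambda>s. to_complex (\<beta> s)) (to_complex p) = 0"
  shows "integral {0..1} (\<lambda>s. g (\<beta> s) * b' s) = \<i> * w * integral \<Omega> (\<lambda>p. gx p + \<i> * gy p)"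
proof -
  obtain \<psi> \<psi>x \<psi>y :: "real \<times> real \<Rightarrow> real" and S where
    dx: "\<And>x y. ((\<lambda>x. \<psi> (x, y)) has_real_derivative \<psi>x (x, y)) (at x)" and
    dy: "\<And>x y. ((\<lambda>y. \<psi> (x, y)) has_real_derivative \<psi>y (x, y)) (at y)" and
    c\<psi>: "continuous_on UNIV \<psi>" "continuous_on UNIV \<psi>x" "continuous_on UNIV \<psi>y" and
    S: "compact S" "S \<subseteq> V" and one: "\<And>p. p \<in> K \<Longrightarrow> \<psi> p = 1" and
    off: "\<And>p. p \<notin> S \<Longrightarrow> \<psi> p = 0 \<and> \<psi>x p = 0 \<and> \<psi>y p = 0"
    using C1_cutoff[OF assms(1-3)] by blast
  let ?v = "\<lambda>f p. if p \<in> V then f p else (0::complex)"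
  define G where "G p = of_real (\<psi> p) * ?v g p" for p
  define Gx where "Gx p = of_real (\<psi> p) * ?v gx p + of_real (\<psi>x p) * ?v g p" for p
  define Gy where "Gy p = of_real (\<psi> p) * ?v gy p + of_real (\<psi>y p) * ?v g p" for p
  have "open (- S)"
    using S(1) compact_imp_closed by blast
  have "bounded S"
    using S(1) by (rule compact_imp_bounded)
  then obtain R0 where R0: "\<And>p. p \<in> S \<Longrightarrow> norm p \<le> R0"
    by (auto simp: bounded_iff)
  have offR: "p \<notin> S" if "R0 + 1 \<le> norm p" for p
    using R0[of p] that by auto
  interpret G: compactly_supported_C1 G Gx Gy "R0 + 1"
  proof
    fix x y :: real
    show "((\<lambda>x. G (x, y)) has_vector_derivative Gx (x, y)) (at x)"
    proof (cases "(x, y) \<in> V")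
      case True
      have op: "open {x. (x, y) \<in> V}"
        by (rule open_sections[OF \<open>open V\<close>])
      have "((\<lambda>x. of_real (\<psi> (x, y)) * g (x, y)) has_vector_derivative Gx (x, y)) (at x)"
        using has_vector_derivative_mult[OF has_vector_derivative_of_real[OF dx] gx[OF True]] True
        by (simp add: Gx_def)
      then show ?thesis
        by (rule has_vector_derivative_transform_within_open[OF _ op]) (use True in \<open>auto simp: G_def\<close>)
    next
      case False
      then have "(x, y) \<notin> S"
        using S(2) by blast
      then show ?thesis
        using off has_vector_derivative_zero_off[OF \<open>open (- S)\<close> refl, of "\<lambda>x. (x, y)" x "\<lambda>x. G (x, y)"]
        by (simp add: Gx_def G_def continuous_intros)
    qed
    show "((\<lambda>y. G (x, y)) has_vector_derivative Gy (x, y)) (at y)"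
    proof (cases "(x, y) \<in> V")
      case True
      have op: "open {y. (x, y) \<in> V}"
        by (rule open_sections[OF \<open>open V\<close>])
      have "((\<lambda>y. of_real (\<psi> (x, y)) * g (x, y)) has_vector_derivative Gy (x, y)) (at y)"
        using has_vector_derivative_mult[OF has_vector_derivative_of_real[OF dy] gy[OF True]] True
        by (simp add: Gy_def)
      then show ?thesis
        by (rule has_vector_derivative_transform_within_open[OF _ op]) (use True in \<open>auto simp: G_def\<close>)
    next
      case False
      then have "(x, y) \<notin> S"
        using S(2) by blast
      then show ?thesis
        using off has_vector_derivative_zero_off[OF \<open>open (- S)\<close> refl, of "\<lambda>y. (x, y)" y "\<lambda>y. G (x, y)"]
        by (simp add: Gy_def G_def continuous_intros)
    qed
  next
    show "continuous_on UNIV G" "continuous_on UNIV Gx" "continuous_on UNIV Gy"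
      unfolding G_def Gx_def Gy_def using off
      by (intro continuous_on_add continuous_on_mult_cutoff[OF S(1) \<open>open V\<close> S(2)] cont c\<psi>; simp)+
  qed (use off offR in \<open>auto simp: G_def Gx_def Gy_def\<close>)
  have flat: "\<psi>x p = 0 \<and> \<psi>y p = 0" if "p \<in> \<Omega>" for p
  proof -
    obtain x y where p: "p = (x, y)"
      by (cases p)
    have "((\<lambda>x. \<psi> (x, y)) has_real_derivative 0) (at x)"
      by (rule has_field_derivative_transform_within_open[OF DERIV_const[of 1] open_sections(1)[OF \<open>open \<Omega>\<close>]])
        (use that p one assms(5) in auto)
    moreover have "((\<lambda>y. \<psi> (x, y)) has_real_derivative 0) (at y)"
      by (rule has_field_derivative_transform_within_open[OF DERIV_const[of 1] open_sections(2)[OF \<open>open \<Omega>\<close>]])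
        (use that p one assms(5) in auto)
    ultimately show ?thesis
      using dx dy p DERIV_unique by blast
  qed
  have eq: "Gx p + \<i> * Gy p = gx p + \<i> * gy p" if "p \<in> \<Omega>" for p
    using that assms(3,5) flat[OF that] one[of p] by (auto simp: Gx_def Gy_def)
  have meas_\<Omega>: "\<Omega> \<in> sets borel"
    using \<open>open \<Omega>\<close> by simp
  have int_G: "integrable lborel (\<lambda>p. Gx p + \<i> * Gy p)"
  proof -
    obtain M where M: "\<And>p. cmod (Gx p) \<le> M" "\<And>p. cmod (Gy p) \<le> M"
      using G.bounded_C1 by metis
    have "cmod (Gx p + \<i> * Gy p) \<le> M + M" for p
      using M[of p] norm_triangle_ineq[of "Gx p" "\<i> * Gy p"] by (simp add: norm_mult)
    then show ?thesis
      by (intro G.integrable_if_bounded[where M = "M + M"]) (auto simp: G.supp)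
  qed
  have si: "set_integrable lborel \<Omega> (\<lambda>p. Gx p + \<i> * Gy p)"
    unfolding set_integrable_def using int_G meas_\<Omega> by (intro integrable_mult_indicator) auto
  have "integral {0..1} (\<lambda>s. g (\<beta> s) * b' s) = integral {0..1} (\<lambda>s. G (\<beta> s) * b' s)"
  proof (rule Henstock_Kurzweil_Integration.integral_cong)
    fix s :: real assume "s \<in> {0..1}"
    then have "\<beta> s \<in> K"
      using \<beta> by blast
    then show "g (\<beta> s) * b' s = G (\<beta> s) * b' s"
      using one[of "\<beta> s"] assms(3) by (auto simp: G_def)
  qed
  also have "\<dots> = \<i> * (LINT p|lborel. (Gx p + \<i> * Gy p) * (w * of_real (indicator \<Omega> p)))"
  proof (rule G.green_winding_number[OF der contb])
    show "(\<lambda>p. w * of_real (indicator \<Omega> p)) \<in> borel_measurable borel"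
      using meas_\<Omega> by measurable
  qed (use w in \<open>auto simp: indicator_def\<close>)
  also have "(\<lambda>p. (Gx p + \<i> * Gy p) * (w * of_real (indicator \<Omega> p))) = (\<lambda>p. w * (indicator \<Omega> p *\<^sub>R (Gx p + \<i> * Gy p)))"
    by (simp add: scaleR_conv_of_real mult_ac)
  also have "(LINT p|lborel. w * (indicator \<Omega> p *\<^sub>R (Gx p + \<i> * Gy p))) = w * integral \<Omega> (\<lambda>p. Gx p + \<i> * Gy p)"
    using set_borel_integral_eq_integral(2)[OF si] by (simp only: integral_mult_right_zero set_lebesgue_integral_def)
  also have "integral \<Omega> (\<lambda>p. Gx p + \<i> * Gy p) = integral \<Omega> (\<lambda>p. gx p + \<i> * gy p)"
    by (rule Henstock_Kurzweil_Integration.integral_cong) (rule eq)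
  finally show "integral {0..1} (\<lambda>s. g (\<beta> s) * b' s) = \<i> * w * integral \<Omega> (\<lambda>p. gx p + \<i> * gy p)"
    by (simp add: mult.assoc)
qed

section \<open>Hopf's Umlaufsatz\<close>

text \<open>Two logarithms of the same value differ by an integer multiple of
  \<open>2 * pi * \<i>\<close>. A continuous function with values in this discrete set is constant
  on an interval.\<close>

lemma continuous_logarithms_same_increment:
  fixes u v :: "real \<Rightarrow> complex"
  assumes "a \<le> b" "continuous_on {a..b} u" "continuous_on {a..b} v"
    and eq: "\<And>t. t \<in> {a..b} \<Longrightarrow> exp (u t) = exp (v t)"
  shows "u b - u a = v b - v a"
proof -
  have "(\<lambda>t. u t - v t) constant_on {a..b}"
  proof (rule continuous_discrete_range_constant)
    show "continuous_on {a..b} (\<lambda>t. u t - v t)"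
      by (intro continuous_intros assms)
    fix x assume x: "x \<in> {a..b}"
    have "2 * pi \<le> cmod ((u y - v y) - (u x - v x))"
      if y: "y \<in> {a..b}" and ne: "u y - v y \<noteq> u x - v x" for y
    proof -
      obtain m n :: int where m: "u y = v y + (of_int (2 * m) * pi) * \<i>"
        and n: "u x = v x + (of_int (2 * n) * pi) * \<i>"
        using eq[OF x] eq[OF y] unfolding exp_eq by blast
      then have "(u y - v y) - (u x - v x) = of_real (2 * pi * of_int (m - n)) * \<i>"
        by (simp add: algebra_simps)
      then have "cmod ((u y - v y) - (u x - v x)) = 2 * pi * \<bar>of_int (m - n)\<bar>"
        by (simp only: norm_mult norm_ii norm_of_real) (simp add: abs_mult)
      moreover have "1 \<le> \<bar>m - n\<bar>"
        using ne m n by auto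
      then have "1 \<le> \<bar>of_int (m - n) :: real\<bar>"
        by linarith
      ultimately show ?thesis
        by simp
    qed
    then show "\<exists>e>0. \<forall>y. y \<in> {a..b} \<and> u y - v y \<noteq> u x - v x \<longrightarrow> e \<le> cmod ((u y - v y) - (u x - v x))"
      by (intro exI[of _ "2 * pi"]) auto
  qed simp
  then obtain c where "\<And>t. t \<in> {a..b} \<Longrightarrow> u t - v t = c"
    unfolding constant_on_def by blast
  from this[of a] this[of b] assms(1) show ?thesis
    by (simp add: algebra_simps)
qed

text \<open>As long as \<open>l\<close> moves by less than \<open>pi\<close>, the difference
  \<open>l t - l s\<close> is the principal logarithm of \<open>f t / f s\<close>, and
  \<open>Ln\<close> has derivative \<open>1\<close> at \<open>1\<close>.\<close>

lemma continuous_logarithm_has_vector_derivative: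
  fixes l f :: "real \<Rightarrow> complex"
  assumes "isCont l s" and f: "(f has_vector_derivative f') (at s)" and eq: "\<And>t. exp (l t) = f t"
  shows "(l has_vector_derivative f' / f s) (at s)"
proof -
  have nz: "f s \<noteq> 0"
    using eq[of s] by (metis exp_not_eq_zero)
  have "\<forall>\<^sub>F t in nhds s. dist (l t) (l s) < pi"
    using assms(1) by (intro tendstoD) (auto simp: isCont_def tendsto_nhds_iff)
  then have ev: "\<forall>\<^sub>F t in nhds s. l s + Ln (f t / f s) = l t"
  proof eventually_elim
    case (elim t)
    then have "\<bar>Im (l t - l s)\<bar> < pi"
      using abs_Im_le_cmod[of "l t - l s"] by (simp only: dist_norm)
    then have "Ln (exp (l t - l s)) = l t - l s"
      by (intro Ln_exp) auto
    then show ?case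
      by (simp add: exp_diff eq)
  qed
  have "((\<lambda>t. f t / f s) has_vector_derivative f' / f s) (at s)"
    by (intro bounded_linear.has_vector_derivative[OF bounded_linear_divide] f)
  moreover have "(Ln has_field_derivative inverse (f s / f s)) (at (f s / f s))"
    using nz by (intro has_field_derivative_Ln) simp
  ultimately have "((\<lambda>t. Ln (f t / f s)) has_vector_derivative f' / f s) (at s)"
    using field_vector_diff_chain_at nz by (fastforce simp: o_def)
  then have "((\<lambda>t. l s + Ln (f t / f s)) has_vector_derivative f' / f s) (at s)"
    using has_vector_derivative_add[OF has_vector_derivative_const[of "l s"]] by fastforce
  then show ?thesis
    using ev by (rule has_vector_derivative_transform_eventually)
qed

text \<open>The secants of a loop of period 1 on the strip \<open>0 \<le> t - s \<le> 1\<close>, divided by \<open>(t - s) (1 - (t - s))\<close>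
  so that they extend continuously and without zeros to both boundary lines. A continuous logarithm
  on the convex strip then compares the tangents (diagonal) with the secants from a lowest point.\<close>
definition mean_velocity :: "(real \<Rightarrow> complex) \<Rightarrow> real \<times> real \<Rightarrow> complex" where
  "mean_velocity b' = (\<lambda>(s, t). integral {0..1} (\<lambda>u. b' (s + u * (t - s))))"

text \<open>The second branch uses that, by periodicity, the chord from \<open>s\<close> to
  \<open>t\<close> is opposite to the chord from \<open>t\<close> to \<open>s + 1\<close>, whose
  parameter length is \<open>1 - (t - s)\<close>. Switching at \<open>1 / 2\<close> keeps both
  denominators at least \<open>1 / 2\<close> on the strip.\<close>

definition normalised_secant :: "(real \<Rightarrow> complex) \<Rightarrow> real \<times> real \<Rightarrow> complex" where
  "normalised_secant b' = (\<lambda>(s, t). if t - s \<le> 1 / 2 then mean_velocity b' (s, t) / of_real (1 - (t - s))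
     else - mean_velocity b' (t, s + 1) / of_real (t - s))"

definition secant_strip :: "(real \<times> real) set" where
  "secant_strip = {(s, t). 0 \<le> t - s \<and> t - s \<le> 1}"

lemma convex_secant_strip: "convex secant_strip"
proof -
  have *: "secant_strip = {p. inner (-1, 1) p \<ge> 0} \<inter> {p. inner (-1, 1) p \<le> 1}"
    by (auto simp: secant_strip_def)
  show ?thesis
    unfolding * by (intro convex_Int convex_halfspace_le convex_halfspace_ge)
qed

section \<open>Secants of a simple loop and the total turning of its tangent\<close>

locale C1_simple_loop =
  fixes b b' :: "real \<Rightarrow> complex"
  assumes deriv: "(b has_vector_derivative b' s) (at s)"
    and cont: "continuous_on UNIV b'"
    and periodic: "b (s + 1) = b s"
    and simple: "inj_on b {0..<1}"
    and regular: "b' s \<noteq> 0"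
begin

sublocale periodic_fun_simple' b
  by unfold_locales (rule periodic)

lemma b'_periodic: "b' (s + 1) = b' s"
proof -
  have "((\<lambda>t::real. t + 1) has_vector_derivative 1) (at s)"
    by (auto intro!: derivative_eq_intros simp: has_vector_derivative_def)
  from vector_diff_chain_at[OF this deriv[of "s + 1"]]
  have "(b has_vector_derivative b' (s + 1)) (at s)"
    by (simp add: o_def periodic)
  then show ?thesis
    using deriv vector_derivative_unique_at by blast
qed

text \<open>Injectivity is given on one period only; passing to fractional parts transfers it to any
  two parameters that are less than a period apart.\<close>

lemma b_neq:
  assumes "0 < t - s" "t - s < 1"
  shows "b s \<noteq> b t"
proof
  assume "b s = b t"
  moreover have "b (frac x) = b x" for x
    using minus_of_int[of x "\<lfloor>x\<rfloor>"] by (simp add: frac_def)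
  ultimately have "b (frac s) = b (frac t)"
    by simp
  then have "frac s = frac t"
    by (rule inj_onD[OF simple]) (simp_all add: frac_lt_1)
  then have "t - s = of_int (\<lfloor>t\<rfloor> - \<lfloor>s\<rfloor>)"
    by (simp add: frac_def)
  with assms have "0 < \<lfloor>t\<rfloor> - \<lfloor>s\<rfloor>" "\<lfloor>t\<rfloor> - \<lfloor>s\<rfloor> < 1"
    by (simp_all only: of_int_0_less_iff of_int_less_1_iff)
  then show False
    by linarith
qed

lemma mean_velocity_same: "mean_velocity b' (s, s) = b' s"
  by (simp add: mean_velocity_def)

text \<open>Hadamard's form of the difference quotient: as an integral of \<open>b'\<close> it also
  makes sense on the diagonal and is jointly continuous there.\<close>

lemma mean_velocity_mult: "of_real (t - s) * mean_velocity b' (s, t) = b t - b s"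
proof -
  have "((\<lambda>u. b (s + u * (t - s))) has_vector_derivative of_real (t - s) * b' (s + u * (t - s))) (at u)" for u
  proof -
    have "((\<lambda>u. s + u * (t - s)) has_vector_derivative (t - s)) (at u)"
      by (auto intro!: derivative_eq_intros simp: has_vector_derivative_def)
    from vector_diff_chain_at[OF this deriv] show ?thesis
      by (simp add: o_def scaleR_conv_of_real)
  qed
  then have "((\<lambda>u. of_real (t - s) * b' (s + u * (t - s))) has_integral b (s + 1 * (t - s)) - b (s + 0 * (t - s))) {0..1}"
    by (intro fundamental_theorem_of_calculus) (auto intro: has_vector_derivative_at_within)
  from integral_unique[OF this] show ?thesis
    by (simp add: mean_velocity_def)
qed

lemma continuous_on_mean_velocity:
  assumes "continuous_on S f" "continuous_on S g"
  shows "continuous_on S (\<lambda>p. mean_velocity b' (f p, g p))"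
proof -
  have "continuous_on UNIV (\<lambda>p. integral (cbox 0 1) ((\<lambda>p u. b' (fst p + u * (snd p - fst p))) p))"
    by (rule integral_continuous_on_param)
      (auto simp: case_prod_beta intro!: continuous_intros continuous_on_compose2[OF cont])
  then have "continuous_on UNIV (mean_velocity b')"
    by (simp add: mean_velocity_def case_prod_beta cbox_interval)
  then show ?thesis
    by (rule continuous_on_compose2) (auto intro!: continuous_intros assms)
qed

lemma normalised_secant_diag: "normalised_secant b' (s, s) = b' s"
  by (simp add: normalised_secant_def mean_velocity_same)

lemma normalised_secant_period: "normalised_secant b' (s, s + 1) = - b' s"
  by (simp add: normalised_secant_def mean_velocity_same b'_periodic)

lemma normalised_secant_interior:
  assumes "0 < t - s" "t - s < 1"
  shows "normalised_secant b' (s, t) = (b t - b s) / of_real ((t - s) * (1 - (t - s)))"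
proof -
  have 1: "mean_velocity b' (s, t) = (b t - b s) / of_real (t - s)"
    using mean_velocity_mult[of t s] assms by (simp add: divide_simps mult.commute)
  have 2: "mean_velocity b' (t, s + 1) = (b s - b t) / of_real (1 - (t - s))"
  proof -
    have "s + 1 - t = 1 - (t - s)"
      by simp
    then have "of_real (1 - (t - s)) * mean_velocity b' (t, s + 1) = b s - b t"
      using mean_velocity_mult[of "s + 1" t] by (simp only: periodic)
    moreover have "of_real (1 - (t - s)) \<noteq> (0 :: complex)"
      using assms by (simp only: of_real_eq_0_iff)
    ultimately show ?thesis
      by (metis nonzero_mult_div_cancel_left)
  qed
  show ?thesis
    by (simp add: normalised_secant_def 1 2 minus_divide_left)
qed

text \<open>Simplicity of the loop keeps the chords nonzero in the open strip; on its two boundary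
  lines the value is a tangent up to sign, nonzero by regularity.\<close>

lemma normalised_secant_nonzero:
  assumes "p \<in> secant_strip"
  shows "normalised_secant b' p \<noteq> 0"
proof -
  obtain s t where p: "p = (s, t)"
    by (cases p)
  consider "t = s" | "t = s + 1" | "0 < t - s" "t - s < 1"
    using assms p by (force simp: secant_strip_def)
  then show ?thesis
  proof cases
    case 3
    then have "of_real ((t - s) * (1 - (t - s))) \<noteq> (0 :: complex)"
      by (simp only: of_real_eq_0_iff) simp
    then show ?thesis
      using b_neq[OF 3] normalised_secant_interior[OF 3] by (simp only: p divide_eq_0_iff) simp
  qed (simp_all add: p normalised_secant_diag normalised_secant_period regular)
qed

lemma continuous_on_normalised_secant: "continuous_on secant_strip (normalised_secant b')"
proof -
  have "continuous_on secant_strip (\<lambda>p. if snd p - fst p \<le> 1 / 2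
      then mean_velocity b' (fst p, snd p) / of_real (1 - (snd p - fst p))
      else - mean_velocity b' (snd p, fst p + 1) / of_real (snd p - fst p))"
  proof (rule continuous_on_cases_le)
    show "continuous_on {p \<in> secant_strip. snd p - fst p \<le> 1 / 2}
        (\<lambda>p. mean_velocity b' (fst p, snd p) / of_real (1 - (snd p - fst p)))"
      by (intro continuous_intros continuous_on_mean_velocity) (simp only: of_real_eq_0_iff, force)
    show "continuous_on {p \<in> secant_strip. 1 / 2 \<le> snd p - fst p}
        (\<lambda>p. - mean_velocity b' (snd p, fst p + 1) / of_real (snd p - fst p))"
      by (intro continuous_intros continuous_on_mean_velocity) (simp only: of_real_eq_0_iff, force)
    show "continuous_on secant_strip (\<lambda>p. snd p - fst p)"
      by (intro continuous_intros)
    \<comment> \<open>On this line the chords from \<open>s\<close> to \<open>t\<close> and from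
      \<open>t\<close> to \<open>s + 1\<close> are opposite and have equal parameter lengths, so the
      two branches agree.\<close>
    fix p :: "real \<times> real" assume p: "snd p - fst p = 1 / 2"
    then have t: "snd p = fst p + 1 / 2"
      by simp
    have "of_real (1 / 2) * mean_velocity b' (fst p, snd p) = - (of_real (1 / 2) * mean_velocity b' (snd p, fst p + 1))"
      using mean_velocity_mult[of "snd p" "fst p"] mean_velocity_mult[of "fst p + 1" "snd p"]
      by (simp add: t periodic) (simp add: field_simps)
    then show "mean_velocity b' (fst p, snd p) / of_real (1 - (snd p - fst p))
        = - mean_velocity b' (snd p, fst p + 1) / of_real (snd p - fst p)"
      by (simp add: p)
  qed
  then show ?thesis
    by (simp add: normalised_secant_def case_prod_beta)
qed

lemma Im_tangent_lowest_point:
  assumes low: "\<And>t. Im (b s) \<le> Im (b t)"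
  shows "Im (b' s) = 0"
proof -
  have "((\<lambda>t. Im (b t)) has_vector_derivative Im (b' s)) (at s)"
    by (rule bounded_linear.has_vector_derivative[OF bounded_linear_Im deriv])
  then have "((\<lambda>t. Im (b t)) has_real_derivative Im (b' s)) (at s)"
    by (simp add: has_real_derivative_iff_has_vector_derivative)
  then show ?thesis
    by (rule DERIV_local_min[of _ _ _ 1]) (use low in auto)
qed

text \<open>All chords issuing from a lowest point lie in the closed upper half-plane. There a
  single branch of the logarithm is available, so the increment depends on the end values
  \<open>b' s\<close> and \<open>- b' s\<close> alone: half a turn, counterclockwise exactly if the
  tangent points to the right.\<close>

lemma secant_from_lowest_point_increment:
  fixes G :: "real \<times> real \<Rightarrow> complex"
  assumes G: "continuous_on secant_strip G" "\<And>p. p \<in> secant_strip \<Longrightarrow> normalised_secant b' p = exp (G p)"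
    and low: "\<And>t. Im (b s) \<le> Im (b t)"
  shows "G (s, s + 1) - G (s, s) = of_real (sgn (Re (b' s)) * pi) * \<i>"
proof -
  have im: "Im (b' s) = 0"
    by (rule Im_tangent_lowest_point[OF low])
  let ?F = "\<lambda>\<tau>. normalised_secant b' (s, s + \<tau>)"
  have strip: "(s, s + \<tau>) \<in> secant_strip" if "\<tau> \<in> {0..1}" for \<tau>
    using that by (simp add: secant_strip_def)
  have cont_leg: "continuous_on {0..1} (\<lambda>\<tau>. h (s, s + \<tau>))" if "continuous_on secant_strip h" for h :: "real \<times> real \<Rightarrow> complex"
    by (rule continuous_on_compose2[OF that]) (use strip in \<open>auto intro!: continuous_intros\<close>)
  \<comment> \<open>Multiplication by \<open>- \<i>\<close> turns the upper half-plane into the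
    right one, away from the cut of \<open>Ln\<close>; adding \<open>\<i> * pi / 2\<close>
    afterwards undoes the rotation.\<close>
  have upper: "- \<i> * ?F \<tau> \<notin> \<real>\<^sub>\<le>\<^sub>0" if \<tau>: "\<tau> \<in> {0..1}" for \<tau>
  proof -
    have "0 \<le> Im (?F \<tau>)"
    proof -
      consider "\<tau> = 0" | "\<tau> = 1" | "0 < \<tau>" "\<tau> < 1"
        using \<tau> by force
      then show ?thesis
      proof cases
        case 3
        then have "?F \<tau> = (b (s + \<tau>) - b s) / of_real (\<tau> * (1 - \<tau>))"
          by (subst normalised_secant_interior) auto
        then have "Im (?F \<tau>) = (Im (b (s + \<tau>)) - Im (b s)) / (\<tau> * (1 - \<tau>))"
          by (simp only: Im_divide_of_real minus_complex.sel)
        then show ?thesis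
          using low[of "s + \<tau>"] 3 by simp
      qed (simp_all add: normalised_secant_diag normalised_secant_period im)
    qed
    moreover have "?F \<tau> \<noteq> 0"
      using strip[OF \<tau>] by (rule normalised_secant_nonzero)
    ultimately show ?thesis
      by (auto simp: complex_nonpos_Reals_iff complex_eq_iff)
  qed
  have "G (s, s + 1) - G (s, s + 0) = (Ln (- \<i> * ?F 1) + \<i> * pi / 2) - (Ln (- \<i> * ?F 0) + \<i> * pi / 2)"
  proof (rule continuous_logarithms_same_increment[of 0 1 "\<lambda>\<tau>. G (s, s + \<tau>)" "\<lambda>\<tau>. Ln (- \<i> * ?F \<tau>) + \<i> * pi / 2"])
    show "continuous_on {0..1} (\<lambda>\<tau>. G (s, s + \<tau>))"
      by (rule cont_leg[OF G(1)])
    show "continuous_on {0..1} (\<lambda>\<tau>. Ln (- \<i> * ?F \<tau>) + \<i> * pi / 2)"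
      by (intro continuous_intros cont_leg[OF continuous_on_normalised_secant] ballI upper)
    fix \<tau> :: real assume \<tau>: "\<tau> \<in> {0..1}"
    have "?F \<tau> \<noteq> 0"
      using strip[OF \<tau>] by (rule normalised_secant_nonzero)
    moreover have "exp (\<i> * pi / 2) = \<i>"
      using cis_conv_exp[of "pi / 2"] by simp
    moreover have "- (\<i> * z * \<i>) = z" for z
      by (simp add: complex_eq_iff)
    ultimately have "exp (Ln (- \<i> * ?F \<tau>) + \<i> * pi / 2) = ?F \<tau>"
      by (simp add: exp_add exp_Ln)
    then show "exp (G (s, s + \<tau>)) = exp (Ln (- \<i> * ?F \<tau>) + \<i> * pi / 2)"
      using G(2)[OF strip[OF \<tau>]] by simp
  qed simp
  then have inc: "G (s, s + 1) - G (s, s) = Ln (\<i> * b' s) - Ln (- \<i> * b' s)"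
    by (simp add: normalised_secant_diag normalised_secant_period)
  have b': "b' s = of_real (Re (b' s))"
    using im by (simp add: complex_eq_iff)
  define r where "r = Re (b' s)"
  have "r \<noteq> 0"
    using regular[of s] b' r_def by auto
  have Ln_pos: "Ln (\<i> * of_real x) = of_real (ln x) + \<i> * pi / 2" "Ln (- \<i> * of_real x) = of_real (ln x) - \<i> * pi / 2"
    if "x > 0" for x
    using that Ln_times_of_real[of x \<i>] Ln_times_of_real[of x "- \<i>"]
    by (simp_all add: mult.commute Ln_of_real)
  show "G (s, s + 1) - G (s, s) = of_real (sgn (Re (b' s)) * pi) * \<i>"
  proof (cases "r > 0")
    case True
    then show ?thesis
      using Ln_pos[OF True] inc b' by (simp add: r_def[symmetric] mult.commute)
  next
    case False
    then have "r < 0"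
      using \<open>r \<noteq> 0\<close> by simp
    then have "- r > 0"
      by simp
    from Ln_pos[OF this] show ?thesis
      using inc b' \<open>r < 0\<close> by (simp add: r_def[symmetric] mult.commute)
  qed
qed

text \<open>A logarithm \<open>G\<close> on the whole strip makes increments independent of the
  path. The diagonal from \<open>(s0, s0)\<close> to \<open>(s0 + 1, s0 + 1)\<close> is exchanged
  for the two legs through \<open>(s0, s0 + 1)\<close>, each of which contributes half a turn in the
  same direction.\<close>

theorem turning_of_tangent:
  assumes b'': "\<And>s. (b' has_vector_derivative b'' s) (at s)"
    and low: "\<And>t. Im (b s0) \<le> Im (b t)" and "0 \<le> s0"
  shows "((\<lambda>s. b'' s / b' s) has_integral (of_real (2 * pi * sgn (Re (b' s0))) * \<i>)) {0..1}"
proof -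
  obtain G where G: "continuous_on secant_strip G" "\<And>p. p \<in> secant_strip \<Longrightarrow> normalised_secant b' p = exp (G p)"
    using continuous_logarithm_on_contractible[OF continuous_on_normalised_secant
        convex_imp_contractible[OF convex_secant_strip] normalised_secant_nonzero] by blast
  define l where "l s = G (s, s)" for s
  have cont_l: "continuous_on UNIV l"
    unfolding l_def by (rule continuous_on_compose2[OF G(1)]) (auto intro!: continuous_intros simp: secant_strip_def)
  have exp_l: "exp (l s) = b' s" for s
    using G(2)[of "(s, s)"] by (simp add: l_def secant_strip_def normalised_secant_diag)
  \<comment> \<open>On the second leg the chord runs from \<open>s0 + \<tau>\<close> to
    \<open>s0 + 1\<close> and is the negative of the chord from \<open>s0\<close> to
    \<open>s0 + \<tau>\<close>. Logarithms of the two legs thus differ by a constant such as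
    \<open>\<i> * pi\<close>, and the increments coincide.\<close>
  have "G (s0 + 1, s0 + 1) - G (s0 + 0, s0 + 1) = (G (s0, s0 + 1) + \<i> * pi) - (G (s0, s0 + 0) + \<i> * pi)"
  proof (rule continuous_logarithms_same_increment[of 0 1 "\<lambda>\<tau>. G (s0 + \<tau>, s0 + 1)" "\<lambda>\<tau>. G (s0, s0 + \<tau>) + \<i> * pi"])
    show "continuous_on {0..1} (\<lambda>\<tau>. G (s0 + \<tau>, s0 + 1))"
      by (rule continuous_on_compose2[OF G(1)]) (auto intro!: continuous_intros simp: secant_strip_def)
    show "continuous_on {0..1} (\<lambda>\<tau>. G (s0, s0 + \<tau>) + \<i> * pi)"
      by (intro continuous_on_add continuous_on_const continuous_on_compose2[OF G(1)])
        (auto intro!: continuous_intros simp: secant_strip_def)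
    fix \<tau> :: real assume \<tau>: "\<tau> \<in> {0..1}"
    have "normalised_secant b' (s0 + \<tau>, s0 + 1) = - normalised_secant b' (s0, s0 + \<tau>)"
    proof -
      consider "\<tau> = 0" | "\<tau> = 1" | "0 < \<tau>" "\<tau> < 1"
        using \<tau> by force
      then show ?thesis
      proof cases
        case 3
        then show ?thesis
          using normalised_secant_interior[of "s0 + 1" "s0 + \<tau>"] normalised_secant_interior[of "s0 + \<tau>" s0]
          by (simp add: periodic mult.commute minus_divide_left)
      qed (simp_all add: normalised_secant_diag normalised_secant_period b'_periodic)
    qed
    then show "exp (G (s0 + \<tau>, s0 + 1)) = exp (G (s0, s0 + \<tau>) + \<i> * pi)"
      using \<tau> G(2)[of "(s0 + \<tau>, s0 + 1)"] G(2)[of "(s0, s0 + \<tau>)"]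
      by (simp add: secant_strip_def exp_add exp_pi_i')
  qed simp
  then have "l (s0 + 1) - l s0 = of_real (2 * pi * sgn (Re (b' s0))) * \<i>"
    using secant_from_lowest_point_increment[OF G low] by (simp add: l_def algebra_simps)
  \<comment> \<open>Since \<open>b'\<close> is periodic, the increment over a full period does not
    depend on its starting point; this moves the start from \<open>s0\<close> to
    \<open>0\<close>.\<close>
  moreover have "l (s0 + 1) - l (0 + 1) = l s0 - l 0"
  proof (rule continuous_logarithms_same_increment[OF \<open>0 \<le> s0\<close>])
    show "continuous_on {0..s0} (\<lambda>s. l (s + 1))"
      by (rule continuous_on_compose2[OF cont_l]) (auto intro!: continuous_intros)
    show "continuous_on {0..s0} l"
      using cont_l by (rule continuous_on_subset) simp
  qed (simp add: exp_l b'_periodic)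
  ultimately have total: "l 1 - l 0 = of_real (2 * pi * sgn (Re (b' s0))) * \<i>"
    by (simp add: algebra_simps)
  have "(l has_vector_derivative b'' s / b' s) (at s)" for s
    using cont_l by (intro continuous_logarithm_has_vector_derivative b'' exp_l)
      (simp add: continuous_on_eq_continuous_at)
  then have "((\<lambda>s. b'' s / b' s) has_integral (l 1 - l 0)) {0..1}"
    by (intro fundamental_theorem_of_calculus) (auto intro: has_vector_derivative_at_within)
  then show ?thesis
    unfolding total .
qed

end

section \<open>The loop in the plane: enclosed region, winding numbers and orientation\<close>

locale C1_simple_plane_loop = C1_simple_loop "\<lambda>s. to_complex (\<beta> s)" b'
  for \<beta> :: "real \<Rightarrow> real \<times> real" and b'
begin

lemma continuous_on_b: "continuous_on UNIV (\<lambda>s. to_complex (\<beta> s))"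
  using deriv by (auto intro: continuous_at_imp_continuous_on has_vector_derivative_continuous)

lemma continuous_on_\<beta>: "continuous_on UNIV \<beta>"
proof -
  have "continuous_on UNIV (\<lambda>s. (Re (to_complex (\<beta> s)), Im (to_complex (\<beta> s))))"
    by (intro continuous_intros continuous_on_b)
  then show ?thesis
    by (simp add: to_complex_def)
qed

lemma \<beta>_frac: "\<beta> (frac s) = \<beta> s"
  using minus_of_int[of s "\<lfloor>s\<rfloor>"] by (simp add: frac_def)

lemma range_\<beta>: "range \<beta> = \<beta> ` {0..1}"
proof -
  have "\<beta> s \<in> \<beta> ` {0..1}" for s
    using frac_lt_1[of s] by (intro image_eqI[of _ _ "frac s"]) (auto simp: \<beta>_frac)
  then show ?thesis
    by blast
qed

lemma compact_range_\<beta>: "compact (range \<beta>)"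
  unfolding range_\<beta>
  by (rule compact_continuous_image[OF continuous_on_subset[OF continuous_on_\<beta> subset_UNIV] compact_Icc])

lemma open_enclosed: "open (inside (range \<beta>))"
  by (intro open_inside compact_imp_closed compact_range_\<beta>)

text \<open>The union is the complement of the open set \<open>outside (range \<beta>)\<close>,
  hence closed. It is the compact set on which area integrands are bounded and around which cutoffs
  are placed.\<close>

lemma compact_enclosed_closure: "compact (inside (range \<beta>) \<union> range \<beta>)"
proof -
  have "inside (range \<beta>) \<union> range \<beta> = - outside (range \<beta>)"
    by (metis Un_commute inside_Un_outside inside_Int_outside outside_no_overlap inside_no_overlap
        Compl_eq_Diff_UNIV Diff_cancel union_with_outside double_complement union_with_inside)
  moreover have "open (outside (range \<beta>))"
    by (intro open_outside compact_imp_closed compact_range_\<beta>)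
  moreover have "bounded (inside (range \<beta>) \<union> range \<beta>)"
    using compact_range_\<beta> by (simp add: bounded_inside compact_imp_bounded)
  ultimately show ?thesis
    by (metis closed_Compl compact_eq_bounded_closed)
qed

text \<open>A point off the curve that is not enclosed lies in an unbounded component of the
  complement. The winding number is constant on this component and zero far away.\<close>

lemma winding_number_outside:
  assumes p: "p \<notin> inside (range \<beta>)" "p \<notin> range \<beta>"
  shows "winding_number (\<lambda>s. to_complex (\<beta> s)) (to_complex p) = 0"
proof -
  let ?\<gamma> = "\<lambda>s. to_complex (\<beta> s)"
  have \<gamma>: "path ?\<gamma>" "pathfinish ?\<gamma> = pathstart ?\<gamma>"
    using continuous_on_b periodic[of 0]
    by (auto simp: path_def pathfinish_def pathstart_def intro: continuous_on_subset)
  obtain B where B: "\<And>z. B \<le> cmod z \<Longrightarrow> winding_number ?\<gamma> z = 0"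
    using winding_number_zero_at_infinity[OF \<gamma>] by blast
  define C where "C = connected_component_set (- range \<beta>) p"
  have "\<not> bounded C"
    using p by (simp add: inside_def C_def)
  then obtain q where q: "q \<in> C" "B \<le> norm q"
    by (meson bounded_iff linear)
  have "C \<subseteq> - range \<beta>"
    unfolding C_def by (rule connected_component_subset)
  then have "to_complex ` C \<inter> path_image ?\<gamma> = {}"
    by (auto simp: path_image_def)
  moreover have "connected (to_complex ` C)"
    unfolding C_def by (intro connected_continuous_image connected_connected_component continuous_intros)
  moreover have "p \<in> C"
    using p(2) by (simp add: C_def)
  ultimately have "winding_number ?\<gamma> (to_complex p) = winding_number ?\<gamma> (to_complex q)"
    using winding_number_constant[OF \<gamma>, of "to_complex ` C"] q(1) unfolding constant_on_def by (metis imageI)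
  then show ?thesis
    using B q(2) by simp
qed

lemma green_loop:
  fixes g gx gy :: "real \<times> real \<Rightarrow> complex" and w :: complex
  assumes V: "open V" "inside (range \<beta>) \<union> range \<beta> \<subseteq> V"
    and gx: "\<And>x y. (x, y) \<in> V \<Longrightarrow> ((\<lambda>x. g (x, y)) has_vector_derivative gx (x, y)) (at x)"
    and gy: "\<And>x y. (x, y) \<in> V \<Longrightarrow> ((\<lambda>y. g (x, y)) has_vector_derivative gy (x, y)) (at y)"
    and cg: "continuous_on V g" "continuous_on V gx" "continuous_on V gy"
    and w: "\<And>p. p \<in> inside (range \<beta>) \<Longrightarrow> winding_number (\<lambda>s. to_complex (\<beta> s)) (to_complex p) = w"
  shows "integral {0..1} (\<lambda>s. g (\<beta> s) * b' s) = \<i> * w * integral (inside (range \<beta>)) (\<lambda>p. gx p + \<i> * gy p)"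
proof -
  have "\<beta> ` {0..1} \<subseteq> inside (range \<beta>) \<union> range \<beta> - inside (range \<beta>)"
    using inside_no_overlap[of "range \<beta>"] by blast
  note green = green_enclosed_region[OF compact_enclosed_closure V open_enclosed Un_upper1 gx gy cg deriv cont this w]
  show "integral {0..1} (\<lambda>s. g (\<beta> s) * b' s) = \<i> * w * integral (inside (range \<beta>)) (\<lambda>p. gx p + \<i> * gy p)"
    by (rule green) (simp_all add: winding_number_outside flip: range_\<beta>)
qed

lemma lowest_point:
  obtains s0 where "0 \<le> s0" "s0 < 1" "\<And>t. Im (to_complex (\<beta> s0)) \<le> Im (to_complex (\<beta> t))"
proof -
  have "continuous_on {0..1} (\<lambda>s. Im (to_complex (\<beta> s)))"
    by (intro continuous_intros continuous_on_subset[OF continuous_on_\<beta>]) simp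
  from continuous_attains_inf[OF compact_Icc _ this]
  obtain s1 where s1: "s1 \<in> {0..1::real}" "\<And>t. t \<in> {0..1} \<Longrightarrow> Im (to_complex (\<beta> s1)) \<le> Im (to_complex (\<beta> t))"
    by fastforce
  show thesis
  proof
    show "0 \<le> frac s1" "frac s1 < 1"
      by (auto simp: frac_lt_1)
    show "Im (to_complex (\<beta> (frac s1))) \<le> Im (to_complex (\<beta> t))" for t
      using s1(2)[of "frac t"] frac_lt_1[of t] by (simp add: \<beta>_frac)
  qed
qed

text \<open>Green's theorem for a function of \<open>y + x\<^sup>2\<close> that is supported near the lowest point (taken as
  the origin) and decreasing reads off the sign of the winding number from the tangent there.\<close>
lemma winding_number_eq_sgn_lowest_tangent:
  fixes w :: real
  assumes w: "\<And>p. p \<in> inside (range \<beta>) \<Longrightarrow> winding_number (\<lambda>s. to_complex (\<beta> s)) (to_complex p) = w"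
    and "w = 1 \<or> w = -1"
    and s0: "0 \<le> s0" "s0 < 1" and low: "\<And>t. Im (to_complex (\<beta> s0)) \<le> Im (to_complex (\<beta> t))"
  shows "sgn (Re (b' s0)) = w"
proof -
  define r where "r = Re (b' s0)"
  have "r \<noteq> 0"
    using regular[of s0] Im_tangent_lowest_point[OF low] by (auto simp: r_def complex_eq_iff)
  \<comment> \<open>Several points of the curve may share the lowest height. The squared horizontal
    distance tells them apart: on the curve \<open>v\<close> is nonnegative and vanishes at the
    chosen lowest point only.\<close>
  define v where "v p = (snd p - snd (\<beta> s0)) + (fst p - fst (\<beta> s0))\<^sup>2" for p
  have cont_v: "continuous_on S v" for S
    unfolding v_def by (intro continuous_intros)
  have snd_low: "snd (\<beta> s0) \<le> snd (\<beta> t)" for t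
    using low[of t] by (simp add: to_complex_def)
  \<comment> \<open>The parameters at which the tangent does not point to the same horizontal side
    as at \<open>s0\<close>. This compact set misses the lowest point, so \<open>v\<close> has a
    positive lower bound \<open>\<delta>\<close> on it and a bump supported in
    \<open>v \<le> \<delta>\<close> ignores it.\<close>
  define A where "A = {s \<in> {0..1}. Re (b' s) * r \<le> 0}"
  have v_pos: "v (\<beta> s) > 0" if s: "s \<in> A" for s
  proof (rule ccontr)
    assume "\<not> 0 < v (\<beta> s)"
    then have "(fst (\<beta> s) - fst (\<beta> s0))\<^sup>2 = 0" "snd (\<beta> s) = snd (\<beta> s0)"
      using snd_low[of s] zero_le_power2[of "fst (\<beta> s) - fst (\<beta> s0)"] unfolding v_def by linarith+
    then have "\<beta> s = \<beta> s0"
      by (simp add: prod_eq_iff)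
    then have "\<not> (0 < s - s0 \<and> s - s0 < 1)" "\<not> (0 < s0 - s \<and> s0 - s < 1)"
      using b_neq[of s s0] b_neq[of s0 s] by auto
    \<comment> \<open>The interval \<open>{0..1}\<close> contains both ends of the period, so for
      \<open>s0 = 0\<close> the lowest point is met again at \<open>s = 1\<close>.\<close>
    then have "s = s0 \<or> s = 0 + 1 \<and> s0 = 0"
      using s s0 by (auto simp: A_def)
    then have "b' s = b' s0"
      using b'_periodic[of 0] by auto
    then show False
      using s \<open>r \<noteq> 0\<close> by (auto simp: A_def r_def mult_le_0_iff)
  qed
  obtain \<delta> where \<delta>: "\<delta> > 0" "\<And>s. s \<in> A \<Longrightarrow> \<delta> \<le> v (\<beta> s)"
  proof (cases "A = {}")
    case False
    have "A = {0..1} \<inter> (\<lambda>s. Re (b' s) * r) -` {..0}"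
      by (auto simp: A_def)
    moreover have "closed ((\<lambda>s. Re (b' s) * r) -` {..0})"
      by (intro continuous_closed_vimage closed_atMost)
        (use cont in \<open>auto intro!: continuous_intros simp: continuous_on_eq_continuous_at\<close>)
    ultimately have "compact A"
      by (simp add: compact_Int_closed)
    moreover have "continuous_on A (\<lambda>s. v (\<beta> s))"
      by (rule continuous_on_compose2[OF cont_v[of UNIV] continuous_on_subset[OF continuous_on_\<beta>]]) auto
    ultimately obtain s1 where "s1 \<in> A" "\<And>s. s \<in> A \<Longrightarrow> v (\<beta> s1) \<le> v (\<beta> s)"
      using continuous_attains_inf[OF _ False] by metis
    then show ?thesis
      using that v_pos by blast
  qed (use that[of 1] in auto)
  define m where "m p = max 0 (\<delta> - v p)" for p
  have m_nonneg: "0 \<le> m p" for p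
    by (simp add: m_def)
  have cont_m: "continuous_on S m" for S
    unfolding m_def by (intro continuous_intros cont_v)
  define g where "g p = complex_of_real ((m p)\<^sup>2)" for p
  define gx where "gx p = complex_of_real (2 * m p * (- (2 * (fst p - fst (\<beta> s0)))))" for p
  define gy where "gy p = complex_of_real (2 * m p * (- 1))" for p
  have dx: "((\<lambda>x. g (x, y)) has_vector_derivative gx (x, y)) (at x)" for x y
  proof -
    have "((\<lambda>x. \<delta> - v (x, y)) has_real_derivative - (2 * (x - fst (\<beta> s0)))) (at x)"
      unfolding v_def by (auto intro!: derivative_eq_intros)
    from DERIV_chain2[OF DERIV_pos_part_square this]
    show ?thesis
      unfolding g_def gx_def m_def fst_conv by (rule has_vector_derivative_of_real)
  qed
  have dy: "((\<lambda>y. g (x, y)) has_vector_derivative gy (x, y)) (at y)" for x y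
  proof -
    have "((\<lambda>y. \<delta> - v (x, y)) has_real_derivative - 1) (at y)"
      unfolding v_def by (auto intro!: derivative_eq_intros)
    from DERIV_chain2[OF DERIV_pos_part_square this]
    show ?thesis
      unfolding g_def gy_def m_def by (rule has_vector_derivative_of_real)
  qed
  have cg: "continuous_on UNIV g" "continuous_on UNIV gx" "continuous_on UNIV gy"
    unfolding g_def gx_def gy_def by (intro continuous_intros cont_m)+
  note green = green_loop[OF open_UNIV subset_UNIV dx dy cg w]
  define J where "J = integral (inside (range \<beta>)) (\<lambda>p. gx p + \<i> * gy p)"
  have "((\<lambda>p. gx p + \<i> * gy p) has_integral J) (inside (range \<beta>))"
  proof -
    have "(\<lambda>p. gx p + \<i> * gy p) absolutely_integrable_on inside (range \<beta>)"
    proof (rule absolutely_integrable_on_subset_compact[OF compact_enclosed_closure])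
      show "continuous_on (inside (range \<beta>) \<union> range \<beta>) (\<lambda>p. gx p + \<i> * gy p)"
        by (intro continuous_intros continuous_on_subset[OF cg(2)] continuous_on_subset[OF cg(3)]) auto
    qed (use open_enclosed in auto)
    then show ?thesis
      by (simp add: J_def absolutely_integrable_on_def integrable_integral)
  qed
  from has_integral_linear[OF this bounded_linear_Im]
  \<comment> \<open>Both \<open>gx\<close> and \<open>gy\<close> are real, so the imaginary part of
    \<open>gx + \<i> * gy\<close> is \<open>gy\<close>, which is nonpositive because the bump
    decreases upwards.\<close>
  have "((\<lambda>p. - (2 * m p)) has_integral Im J) (inside (range \<beta>))"
    by (simp add: o_def gx_def gy_def)
  from has_integral_neg[OF this] have "0 \<le> - Im J"
    by (rule has_integral_nonneg) (simp add: m_nonneg)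
  then have "Im J \<le> 0"
    by simp
  have cont_gb: "continuous_on {0..1} (\<lambda>s. g (\<beta> s) * b' s)"
    by (intro continuous_on_mult continuous_on_compose2[OF cg(1)] continuous_on_subset[OF continuous_on_\<beta>]
        continuous_on_subset[OF cont]) auto
  then have "((\<lambda>s. g (\<beta> s) * b' s) has_integral (\<i> * w * J)) {0..1}"
    using green unfolding J_def by (metis integrable_continuous_interval integrable_integral)
  from has_integral_linear[OF this bounded_linear_Re]
  have "((\<lambda>s. (m (\<beta> s))\<^sup>2 * Re (b' s)) has_integral (- (w * Im J))) {0..1}"
    by (simp add: o_def g_def)
  from has_integral_mult_left[OF this, of r]
  have int: "((\<lambda>s. (m (\<beta> s))\<^sup>2 * Re (b' s) * r) has_integral (- (w * Im J) * r)) (cbox 0 1)"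
    by (simp add: cbox_interval)
  have nonneg: "0 \<le> (m (\<beta> s))\<^sup>2 * Re (b' s) * r" if "s \<in> {0..1}" for s
  proof (cases "s \<in> A")
    case True
    then have "m (\<beta> s) = 0"
      using \<delta>(2)[of s] by (simp add: m_def)
    then show ?thesis
      by simp
  next
    case False
    then show ?thesis
      using that by (simp add: A_def mult.assoc)
  qed
  \<comment> \<open>A continuous nonnegative integrand with zero integral vanishes identically, but
    at \<open>s0\<close>, where \<open>v\<close> is \<open>0\<close>, the value is
    \<open>(\<delta> * r)\<^sup>2\<close>.\<close>
  have "- (w * Im J) * r \<noteq> 0"
  proof
    assume "- (w * Im J) * r = 0"
    then have "((\<lambda>s. (m (\<beta> s))\<^sup>2 * Re (b' s) * r) has_integral 0) (cbox 0 1)"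
      using int by (simp only:)
    moreover have "continuous_on (cbox 0 1) (\<lambda>s. (m (\<beta> s))\<^sup>2 * Re (b' s) * r)"
      by (intro continuous_intros continuous_on_compose2[OF cont_m[of UNIV]] continuous_on_subset[OF continuous_on_\<beta>]
        continuous_on_subset[OF cont]) auto
    ultimately have "(m (\<beta> s0))\<^sup>2 * Re (b' s0) * r = 0"
      using s0 nonneg by (intro has_integral_0_cbox_imp_0[of 0 1 "\<lambda>s. (m (\<beta> s))\<^sup>2 * Re (b' s) * r"]) (auto simp: cbox_interval)
    then show False
      using \<open>r \<noteq> 0\<close> \<delta>(1) by (simp add: r_def m_def v_def)
  qed
  moreover have "0 \<le> - (w * Im J) * r"
    by (rule has_integral_nonneg[OF int]) (use nonneg in \<open>auto simp: cbox_interval\<close>)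
  ultimately have "0 < - (w * Im J) * r"
    by linarith
  then have "0 < - Im J * (w * r)"
    by (simp add: mult_ac)
  then have "0 < w * r"
    using \<open>Im J \<le> 0\<close> mult_nonpos_nonpos[of "Im J" "w * r"] by (intro ccontr[of "0 < w * r"]) auto
  then show ?thesis
    using assms(2) by (auto simp: r_def sgn_if)
qed

theorem umlaufsatz:
  fixes w :: real
  assumes b'': "\<And>s. (b' has_vector_derivative b'' s) (at s)"
    and w: "\<And>p. p \<in> inside (range \<beta>) \<Longrightarrow> winding_number (\<lambda>s. to_complex (\<beta> s)) (to_complex p) = w"
      "w = 1 \<or> w = -1"
  shows "((\<lambda>s. b'' s / b' s) has_integral (of_real (2 * pi * w) * \<i>)) {0..1}"
proof -
  obtain s0 where s0: "0 \<le> s0" "s0 < 1" "\<And>t. Im (to_complex (\<beta> s0)) \<le> Im (to_complex (\<beta> t))"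
    by (rule lowest_point) blast
  show ?thesis
    using turning_of_tangent[OF b'' s0(3,1)] winding_number_eq_sgn_lowest_tangent[OF w s0] by simp
qed

end

section \<open>The potential and its level function\<close>

lemma DERIV_inverse_sqrt_power:
  assumes "(u has_real_derivative 2 * d) (at t)" "u t > 0"
  shows "((\<lambda>t. 1 / sqrt (u t) ^ Suc n) has_real_derivative - (real (Suc n) * d * (1 / sqrt (u t) ^ (n + 3)))) (at t)"
proof -
  let ?q = "\<lambda>t. sqrt (u t)"
  have "(?q has_real_derivative d * inverse (?q t)) (at t)"
    using assms by (auto intro!: derivative_eq_intros)
  from DERIV_inverse_fun[OF DERIV_power_Suc[OF this, of n]] assms(2)
  have "((\<lambda>t. 1 / ?q t ^ Suc n) has_real_derivative
      - ((1 + real n) * (d * inverse (?q t) * ?q t ^ n) * inverse ((?q t ^ Suc n) ^ Suc (Suc 0)))) (at t)"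
    by (simp add: inverse_eq_divide)
  moreover have "(1 + real n) * (d * inverse q * q ^ n) * inverse ((q ^ Suc n) ^ Suc (Suc 0))
      = real (Suc n) * d * (1 / q ^ (n + 3))" if "q > 0" for q :: real
    using that by (simp add: field_simps power_add eval_nat_numeral)
  ultimately show ?thesis
    using assms(2) by (simp only: real_sqrt_gt_zero)
qed

text \<open>The distance is taken to the point \<open>(- a, 0)\<close>, so \<open>a = \<mu>\<close>
  and \<open>a = \<mu> - 1\<close> give the two primaries. Differentiation raises the exponent by
  two: the powers 1, 3 and 5 express \<open>omega\<close> and its first and second
  derivatives.\<close>

definition inverse_distance_power :: "nat \<Rightarrow> real \<Rightarrow> real \<times> real \<Rightarrow> real" where
  "inverse_distance_power n a p = 1 / sqrt ((fst p + a)\<^sup>2 + (snd p)\<^sup>2) ^ n"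

lemma sum_squares_pos: "p \<noteq> (- a, 0) \<Longrightarrow> 0 < (fst p + a)\<^sup>2 + (snd p :: real)\<^sup>2"
  by (cases p) (simp add: sum_power2_gt_zero_iff)

lemma DERIV_inverse_distance_power:
  assumes "(x, y) \<noteq> (- a, 0)"
  shows "((\<lambda>x. inverse_distance_power (Suc n) a (x, y)) has_real_derivative
      - (real (Suc n) * (x + a) * inverse_distance_power (n + 3) a (x, y))) (at x)"
    and "((\<lambda>y. inverse_distance_power (Suc n) a (x, y)) has_real_derivative
      - (real (Suc n) * y * inverse_distance_power (n + 3) a (x, y))) (at y)"
proof -
  have pos: "0 < (x + a)\<^sup>2 + y\<^sup>2"
    using sum_squares_pos[OF assms] by simp
  have dx: "((\<lambda>x. (x + a)\<^sup>2 + y\<^sup>2) has_real_derivative 2 * (x + a)) (at x)"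
    and dy: "((\<lambda>y. (x + a)\<^sup>2 + y\<^sup>2) has_real_derivative 2 * y) (at y)"
    by (auto intro!: derivative_eq_intros)
  show "((\<lambda>x. inverse_distance_power (Suc n) a (x, y)) has_real_derivative
      - (real (Suc n) * (x + a) * inverse_distance_power (n + 3) a (x, y))) (at x)"
    using DERIV_inverse_sqrt_power[OF dx pos, of n]
    by (simp only: inverse_distance_power_def fst_conv snd_conv)
  show "((\<lambda>y. inverse_distance_power (Suc n) a (x, y)) has_real_derivative
      - (real (Suc n) * y * inverse_distance_power (n + 3) a (x, y))) (at y)"
    using DERIV_inverse_sqrt_power[OF dy pos, of n]
    by (simp only: inverse_distance_power_def fst_conv snd_conv)
qed

lemma continuous_on_inverse_distance_power:
  assumes "(- a, 0) \<notin> S"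
  shows "continuous_on S (inverse_distance_power n a)"
proof -
  have "sqrt ((fst p + a)\<^sup>2 + (snd p)\<^sup>2) \<noteq> 0" if "p \<in> S" for p
    using sum_squares_pos[of p a] assms that by (metis less_irrefl real_sqrt_eq_zero_cancel_iff)
  then show ?thesis
    unfolding inverse_distance_power_def by (intro continuous_intros) auto
qed

context
  fixes \<mu> :: real
begin

private abbreviation "D n \<equiv> inverse_distance_power n \<mu>"
private abbreviation "D' n \<equiv> inverse_distance_power n (\<mu> - 1)"

definition omega_x :: "real \<times> real \<Rightarrow> real" where
  "omega_x p = fst p - (1 - \<mu>) * (fst p + \<mu>) * D 3 p - \<mu> * (fst p + (\<mu> - 1)) * D' 3 p"

definition omega_y :: "real \<times> real \<Rightarrow> real" where
  "omega_y p = snd p - (1 - \<mu>) * snd p * D 3 p - \<mu> * snd p * D' 3 p"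

definition omega_xx :: "real \<times> real \<Rightarrow> real" where
  "omega_xx p = 1 - (1 - \<mu>) * (D 3 p - 3 * (fst p + \<mu>)\<^sup>2 * D 5 p)
     - \<mu> * (D' 3 p - 3 * (fst p + (\<mu> - 1))\<^sup>2 * D' 5 p)"

definition omega_xy :: "real \<times> real \<Rightarrow> real" where
  "omega_xy p = (1 - \<mu>) * (3 * (fst p + \<mu>) * snd p * D 5 p) + \<mu> * (3 * (fst p + (\<mu> - 1)) * snd p * D' 5 p)"

definition omega_yy :: "real \<times> real \<Rightarrow> real" where
  "omega_yy p = 1 - (1 - \<mu>) * (D 3 p - 3 * (snd p)\<^sup>2 * D 5 p) - \<mu> * (D' 3 p - 3 * (snd p)\<^sup>2 * D' 5 p)"

lemma omega_eq: "omega \<mu> p = ((fst p)\<^sup>2 + (snd p)\<^sup>2) / 2 + (1 - \<mu>) * D (Suc 0) p + \<mu> * D' (Suc 0) p"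
  by (simp add: omega_def inverse_distance_power_def case_prod_beta add_diff_eq)

lemma primaries_iff: "p \<notin> primaries \<mu> \<longleftrightarrow> p \<noteq> (- \<mu>, 0) \<and> p \<noteq> (- (\<mu> - 1), 0)"
  by (auto simp: primaries_def)

lemma continuous_on_omega:
  assumes "S \<inter> primaries \<mu> = {}"
  shows "continuous_on S (omega \<mu>)" "continuous_on S omega_x" "continuous_on S omega_y"
    "continuous_on S omega_xx" "continuous_on S omega_xy" "continuous_on S omega_yy"
proof -
  have notin: "(- \<mu>, 0) \<notin> S" "(- (\<mu> - 1), 0) \<notin> S"
    using assms by (auto simp: primaries_def)
  show "continuous_on S (omega \<mu>)" "continuous_on S omega_x" "continuous_on S omega_y"
    "continuous_on S omega_xx" "continuous_on S omega_xy" "continuous_on S omega_yy"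
    unfolding omega_eq omega_x_def omega_y_def omega_xx_def omega_xy_def omega_yy_def
    by (intro continuous_intros continuous_on_inverse_distance_power notin; simp)+
qed

lemma DERIV_omega:
  assumes "(x, y) \<notin> primaries \<mu>"
  shows "((\<lambda>x. omega \<mu> (x, y)) has_real_derivative omega_x (x, y)) (at x)"
    and "((\<lambda>y. omega \<mu> (x, y)) has_real_derivative omega_y (x, y)) (at y)"
    and "((\<lambda>x. omega_x (x, y)) has_real_derivative omega_xx (x, y)) (at x)"
    and "((\<lambda>y. omega_x (x, y)) has_real_derivative omega_xy (x, y)) (at y)"
    and "((\<lambda>x. omega_y (x, y)) has_real_derivative omega_xy (x, y)) (at x)"
    and "((\<lambda>y. omega_y (x, y)) has_real_derivative omega_yy (x, y)) (at y)"
proof -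
  have p: "(x, y) \<noteq> (- \<mu>, 0)" "(x, y) \<noteq> (- (\<mu> - 1), 0)"
    using assms unfolding primaries_iff by blast+
  \<comment> \<open>The instances \<open>n = 0\<close> and \<open>n = 2\<close> differentiate the
    powers 1 and 3; \<open>num\<close> brings their exponents into the form in which they occur in
    the formulas.\<close>
  have num: "Suc 2 = 3" "0 + 3 = (3::nat)" "2 + 3 = (5::nat)" "real (Suc 0) = 1" "real 3 = 3"
    by simp_all
  note d = DERIV_inverse_distance_power[OF p(1), of 0, unfolded num] DERIV_inverse_distance_power[OF p(2), of 0, unfolded num]
    DERIV_inverse_distance_power[OF p(1), of 2, unfolded num] DERIV_inverse_distance_power[OF p(2), of 2, unfolded num]
  show "((\<lambda>x. omega \<mu> (x, y)) has_real_derivative omega_x (x, y)) (at x)"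
    unfolding omega_eq omega_x_def fst_conv snd_conv
    by (auto intro!: derivative_eq_intros d simp: algebra_simps)
  show "((\<lambda>y. omega \<mu> (x, y)) has_real_derivative omega_y (x, y)) (at y)"
    unfolding omega_eq omega_y_def fst_conv snd_conv
    by (auto intro!: derivative_eq_intros d simp: algebra_simps)
  show "((\<lambda>x. omega_x (x, y)) has_real_derivative omega_xx (x, y)) (at x)"
    unfolding omega_x_def omega_xx_def fst_conv snd_conv
    by (auto intro!: derivative_eq_intros d; simp add: algebra_simps power2_eq_square)
  show "((\<lambda>y. omega_x (x, y)) has_real_derivative omega_xy (x, y)) (at y)"
    unfolding omega_x_def omega_xy_def fst_conv snd_conv
    by (auto intro!: derivative_eq_intros d; simp add: algebra_simps power2_eq_square)
  show "((\<lambda>x. omega_y (x, y)) has_real_derivative omega_xy (x, y)) (at x)"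
    unfolding omega_y_def omega_xy_def fst_conv snd_conv
    by (auto intro!: derivative_eq_intros d; simp add: algebra_simps power2_eq_square)
  show "((\<lambda>y. omega_y (x, y)) has_real_derivative omega_yy (x, y)) (at y)"
    unfolding omega_y_def omega_yy_def fst_conv snd_conv
    by (auto intro!: derivative_eq_intros d; simp add: algebra_simps power2_eq_square)
qed

lemma partial_omega:
  assumes "p \<notin> primaries \<mu>"
  shows "partial1 (omega \<mu>) p = omega_x p" "partial2 (omega \<mu>) p = omega_y p"
  using DERIV_omega(1,2)[of "fst p" "snd p"] assms
  by (auto simp: partial1_def partial2_def intro!: DERIV_imp_deriv)

end

section \<open>The logarithm of the speed and its derivatives\<close>

lemma bounded_linear_to_complex: "bounded_linear to_complex"
proof -
  have "linear to_complex"
    by (intro linearI) (simp_all add: to_complex_def complex_eq_iff)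
  then show ?thesis
    by (simp add: linear_conv_bounded_linear)
qed

context
  fixes \<mu> C :: real
begin

private abbreviation "E p \<equiv> 2 * omega \<mu> p - C"

text \<open>Hill's region without its zero-velocity curve: an open set on which
  \<open>ln (speed \<mu> C p)\<close> has continuous second derivatives, available as the
  neighbourhood \<open>V\<close> in Green's theorem.\<close>

definition hill_interior :: "(real \<times> real) set" where
  "hill_interior = {p. p \<notin> primaries \<mu> \<and> 0 < E p}"

text \<open>Since \<open>ln (speed \<mu> C p)\<close> is half of \<open>ln (E p)\<close>, the factor
  \<open>2\<close> in the derivative of \<open>E\<close> cancels.\<close>

definition ln_speed_x :: "real \<times> real \<Rightarrow> real" where
  "ln_speed_x p = omega_x \<mu> p / E p"

definition ln_speed_y :: "real \<times> real \<Rightarrow> real" where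
  "ln_speed_y p = omega_y \<mu> p / E p"

definition ln_speed_xx :: "real \<times> real \<Rightarrow> real" where
  "ln_speed_xx p = (omega_xx \<mu> p * E p - omega_x \<mu> p * (2 * omega_x \<mu> p)) / (E p * E p)"

definition ln_speed_xy :: "real \<times> real \<Rightarrow> real" where
  "ln_speed_xy p = (omega_xy \<mu> p * E p - omega_x \<mu> p * (2 * omega_y \<mu> p)) / (E p * E p)"

definition ln_speed_yy :: "real \<times> real \<Rightarrow> real" where
  "ln_speed_yy p = (omega_yy \<mu> p * E p - omega_y \<mu> p * (2 * omega_y \<mu> p)) / (E p * E p)"

lemma open_hill_interior: "open hill_interior"
proof -
  have "hill_interior = (- primaries \<mu>) \<inter> E -` {0<..}"
    by (auto simp: hill_interior_def)
  moreover have "open (- primaries \<mu>)"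
    by (simp add: primaries_def open_Compl)
  ultimately show ?thesis
    by (auto intro!: continuous_open_preimage continuous_intros continuous_on_omega)
qed

lemma continuous_on_ln_speed:
  "continuous_on hill_interior ln_speed_x" "continuous_on hill_interior ln_speed_y"
  "continuous_on hill_interior ln_speed_xx" "continuous_on hill_interior ln_speed_xy"
  "continuous_on hill_interior ln_speed_yy"
proof -
  have disj: "hill_interior \<inter> primaries \<mu> = {}"
    by (auto simp: hill_interior_def)
  show "continuous_on hill_interior ln_speed_x" "continuous_on hill_interior ln_speed_y"
    "continuous_on hill_interior ln_speed_xx" "continuous_on hill_interior ln_speed_xy"
    "continuous_on hill_interior ln_speed_yy"
    unfolding ln_speed_x_def ln_speed_y_def ln_speed_xx_def ln_speed_xy_def ln_speed_yy_def
    by (intro continuous_intros continuous_on_omega[OF disj]; simp add: hill_interior_def)+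
qed

lemma DERIV_ln_speed:
  assumes p: "(x, y) \<in> hill_interior"
  shows "((\<lambda>x. ln (speed \<mu> C (x, y))) has_real_derivative ln_speed_x (x, y)) (at x)"
    and "((\<lambda>y. ln (speed \<mu> C (x, y))) has_real_derivative ln_speed_y (x, y)) (at y)"
    and "((\<lambda>x. ln_speed_x (x, y)) has_real_derivative ln_speed_xx (x, y)) (at x)"
    and "((\<lambda>y. ln_speed_x (x, y)) has_real_derivative ln_speed_xy (x, y)) (at y)"
    and "((\<lambda>x. ln_speed_y (x, y)) has_real_derivative ln_speed_xy (x, y)) (at x)"
    and "((\<lambda>y. ln_speed_y (x, y)) has_real_derivative ln_speed_yy (x, y)) (at y)"
proof -
  have pos: "E (x, y) > 0" and np: "(x, y) \<notin> primaries \<mu>"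
    using p by (auto simp: hill_interior_def)
  note d = DERIV_omega[OF np]
  have Ex: "((\<lambda>x. E (x, y)) has_real_derivative 2 * omega_x \<mu> (x, y)) (at x)"
    and Ey: "((\<lambda>y. E (x, y)) has_real_derivative 2 * omega_y \<mu> (x, y)) (at y)"
    by (auto intro!: derivative_eq_intros d)
  have ln_sqrt: "((\<lambda>t. ln (sqrt (u t))) has_real_derivative d / u t) (at t)"
    if "(u has_real_derivative 2 * d) (at t)" "u t > 0" for u :: "real \<Rightarrow> real" and d t
    using that by (auto intro!: derivative_eq_intros simp: divide_simps)
  show "((\<lambda>x. ln (speed \<mu> C (x, y))) has_real_derivative ln_speed_x (x, y)) (at x)"
    "((\<lambda>y. ln (speed \<mu> C (x, y))) has_real_derivative ln_speed_y (x, y)) (at y)"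
    unfolding speed_def ln_speed_x_def ln_speed_y_def by (rule ln_sqrt[OF Ex pos] ln_sqrt[OF Ey pos])+
  have nz: "E (x, y) \<noteq> 0"
    using pos by simp
  show "((\<lambda>x. ln_speed_x (x, y)) has_real_derivative ln_speed_xx (x, y)) (at x)"
    "((\<lambda>y. ln_speed_x (x, y)) has_real_derivative ln_speed_xy (x, y)) (at y)"
    "((\<lambda>y. ln_speed_y (x, y)) has_real_derivative ln_speed_yy (x, y)) (at y)"
    unfolding ln_speed_x_def ln_speed_y_def ln_speed_xx_def ln_speed_xy_def ln_speed_yy_def
    by (rule DERIV_divide d Ex Ey nz)+
  show "((\<lambda>x. ln_speed_y (x, y)) has_real_derivative ln_speed_xy (x, y)) (at x)"
    unfolding ln_speed_y_def ln_speed_xy_def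
    using DERIV_divide[OF d(5) Ex nz] by (simp add: mult.commute mult.left_commute)
qed

text \<open>The outer \<open>deriv\<close> sees the inner partial derivative as a function. The
  closed form of the latter is therefore needed near \<open>p\<close> and not only at
  \<open>p\<close>, which openness of \<open>hill_interior\<close> provides.\<close>

lemma laplacian_ln_speed:
  assumes "p \<in> hill_interior"
  shows "laplacian (\<lambda>p. ln (speed \<mu> C p)) p = ln_speed_xx p + ln_speed_yy p"
proof -
  have 1: "partial1 (\<lambda>p. ln (speed \<mu> C p)) q = ln_speed_x q"
    and 2: "partial2 (\<lambda>p. ln (speed \<mu> C p)) q = ln_speed_y q" if "q \<in> hill_interior" for q
    using DERIV_ln_speed(1,2)[of "fst q" "snd q"] that
    by (auto simp: partial1_def partial2_def intro!: DERIV_imp_deriv)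
  obtain x y where p: "p = (x, y)"
    by (cases p)
  have "((\<lambda>x. partial1 (\<lambda>p. ln (speed \<mu> C p)) (x, y)) has_real_derivative ln_speed_xx (x, y)) (at x)"
    by (rule has_field_derivative_transform_within_open[OF DERIV_ln_speed(3) open_sections(1)[OF open_hill_interior]])
      (use assms p 1 in auto)
  moreover have "((\<lambda>y. partial2 (\<lambda>p. ln (speed \<mu> C p)) (x, y)) has_real_derivative ln_speed_yy (x, y)) (at y)"
    by (rule has_field_derivative_transform_within_open[OF DERIV_ln_speed(6) open_sections(2)[OF open_hill_interior]])
      (use assms p 2 in auto)
  ultimately show ?thesis
    unfolding laplacian_def p partial1_def[of "partial1 _"] partial2_def[of "partial2 _"] fst_conv snd_conv
    by (simp add: DERIV_imp_deriv)
qed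

end

section \<open>The periodic orbit: turning rate, flux and period\<close>

locale pcr3bp_loop =
  fixes \<mu> C T :: real and \<alpha> :: "real \<Rightarrow> real \<times> real"
  assumes solution: "pcr3bp_solution \<mu> \<alpha>" and jacobi: "jacobian_integral \<mu> \<alpha> C"
    and T: "0 < T" and period: "\<alpha> (t + T) = \<alpha> t"
    and reg: "norm (velocity \<alpha> t) \<noteq> 0"
    and inj: "inj_on \<alpha> {0..<T}"
    and region: "enclosed_region \<alpha> \<subseteq> U \<mu> C" "\<forall>p \<in> enclosed_region \<alpha>. speed \<mu> C p > 0"
begin

definition "\<beta> s = \<alpha> (T * s)"
definition "\<beta>' s = of_real T * to_complex (velocity \<alpha> (T * s))"
definition "\<beta>'' s = of_real (T\<^sup>2) * to_complex (velocity (velocity \<alpha>) (T * s))"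

lemma rescale:
  assumes "f differentiable (at (T * s))"
  shows "((\<lambda>s. to_complex (f (T * s))) has_vector_derivative of_real T * to_complex (velocity f (T * s))) (at s)"
proof -
  have "(f has_vector_derivative velocity f (T * s)) (at (T * s))"
    using assms by (simp add: velocity_def vector_derivative_works[symmetric])
  moreover have "((\<lambda>s. T * s) has_vector_derivative T) (at s)"
    by (auto intro!: derivative_eq_intros simp: has_vector_derivative_def)
  ultimately have "((\<lambda>s. f (T * s)) has_vector_derivative T *\<^sub>R velocity f (T * s)) (at s)"
    using vector_diff_chain_at by (fastforce simp: o_def)
  moreover have "to_complex (c *\<^sub>R p) = of_real c * to_complex p" for c p
    by (simp add: to_complex_def complex_eq_iff)
  ultimately show ?thesis
    using bounded_linear.has_vector_derivative[OF bounded_linear_to_complex] by metis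
qed

lemma deriv_\<beta>: "((\<lambda>s. to_complex (\<beta> s)) has_vector_derivative \<beta>' s) (at s)"
  unfolding \<beta>_def \<beta>'_def by (rule rescale) (use solution in \<open>simp add: pcr3bp_solution_def\<close>)

lemma deriv_\<beta>': "(\<beta>' has_vector_derivative \<beta>'' s) (at s)"
proof -
  have "((\<lambda>s. to_complex (velocity \<alpha> (T * s))) has_vector_derivative
      of_real T * to_complex (velocity (velocity \<alpha>) (T * s))) (at s)"
    by (rule rescale) (use solution in \<open>simp add: pcr3bp_solution_def\<close>)
  from bounded_linear.has_vector_derivative[OF bounded_linear_mult_right this] show ?thesis
    by (simp add: \<beta>'_def[abs_def] \<beta>''_def power2_eq_square mult.assoc)
qed

sublocale C1_simple_plane_loop \<beta> \<beta>'
proof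
  show "((\<lambda>s. to_complex (\<beta> s)) has_vector_derivative \<beta>' s) (at s)" for s
    by (rule deriv_\<beta>)
  show "continuous_on UNIV \<beta>'"
    using deriv_\<beta>' by (auto intro: continuous_at_imp_continuous_on has_vector_derivative_continuous)
  show "to_complex (\<beta> (s + 1)) = to_complex (\<beta> s)" for s
    using period[of "T * s"] by (simp add: \<beta>_def algebra_simps)
  show "inj_on (\<lambda>s. to_complex (\<beta> s)) {0..<1}"
  proof (rule inj_onI)
    fix s t :: real assume st: "s \<in> {0..<1}" "t \<in> {0..<1}" "to_complex (\<beta> s) = to_complex (\<beta> t)"
    then have "T * s = T * t"
      using T by (intro inj_onD[OF inj]) (auto simp: \<beta>_def)
    then show "s = t"
      using T by simp
  qed
  show "\<beta>' s \<noteq> 0" for s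
    using T reg[of "T * s"] norm_to_complex[of "velocity \<alpha> (T * s)"] by (auto simp: \<beta>'_def simp del: norm_to_complex)
qed

lemma range_eq: "range \<beta> = range \<alpha>"
proof -
  have "\<alpha> t = \<beta> (t / T)" for t
    using T by (simp add: \<beta>_def)
  then have "range \<alpha> \<subseteq> range \<beta>"
    by blast
  then show ?thesis
    by (auto simp: \<beta>_def)
qed

lemma enclosed_eq: "enclosed_region \<alpha> = inside (range \<beta>)"
  by (simp add: enclosed_region_def range_eq)

lemma velocity_norm: "(fst (velocity \<alpha> t))\<^sup>2 + (snd (velocity \<alpha> t))\<^sup>2 = 2 * omega \<mu> (\<alpha> t) - C"
  using jacobi unfolding jacobian_integral_def by (smt (verit))

text \<open>Enclosed points avoid the primaries as members of \<open>U \<mu> C\<close> and have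
  positive speed by assumption. On the orbit itself the Jacobian integral identifies
  \<open>2 * omega \<mu> p - C\<close> with the squared velocity, which is positive by
  regularity.\<close>

lemma closure_subset_hill: "inside (range \<beta>) \<union> range \<beta> \<subseteq> hill_interior \<mu> C"
proof -
  have "p \<in> hill_interior \<mu> C" if "p \<in> inside (range \<beta>)" for p
    using region that unfolding enclosed_eq by (auto simp: hill_interior_def U_def speed_def)
  moreover have "\<alpha> t \<in> hill_interior \<mu> C" for t
  proof -
    have "velocity \<alpha> t \<noteq> 0"
      using reg[of t] by simp
    then have "0 < (fst (velocity \<alpha> t))\<^sup>2 + (snd (velocity \<alpha> t))\<^sup>2"
      by (simp add: sum_power2_gt_zero_iff prod_eq_iff)
    then show ?thesis
      using velocity_norm[of t] solution by (simp add: hill_interior_def pcr3bp_solution_def)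
  qed
  ultimately show ?thesis
    unfolding range_eq by blast
qed

lemma absolutely_integrable_laplacian:
  "laplacian (\<lambda>p. ln (speed \<mu> C p)) absolutely_integrable_on inside (range \<beta>)"
proof (rule absolutely_integrable_on_subset_compact[OF compact_enclosed_closure])
  have "continuous_on (inside (range \<beta>) \<union> range \<beta>) (\<lambda>p. ln_speed_xx \<mu> C p + ln_speed_yy \<mu> C p)"
    by (intro continuous_intros continuous_on_subset[OF continuous_on_ln_speed(3) closure_subset_hill]
        continuous_on_subset[OF continuous_on_ln_speed(5) closure_subset_hill])
  then show "continuous_on (inside (range \<beta>) \<union> range \<beta>) (laplacian (\<lambda>p. ln (speed \<mu> C p)))"
    using closure_subset_hill by (subst continuous_on_cong[OF refl laplacian_ln_speed]) auto
qed (use open_enclosed in auto)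

text \<open>The conjugate of the gradient of \<open>ln (speed \<mu> C p)\<close>. With this sign,
  \<open>gx + \<i> * gy\<close> loses its mixed derivatives and becomes the Laplacian, while
  \<open>Im (grad (\<beta> s) * \<beta>' s)\<close> is the flux density through the curve.\<close>

definition "grad p = Complex (ln_speed_x \<mu> C p) (- ln_speed_y \<mu> C p)"

text \<open>The Coriolis term contributes the constant \<open>- 2 * T\<close> to the rotation of the velocity.\<close>
lemma turning_rate: "Im (\<beta>'' s / \<beta>' s) = - Im (grad (\<beta> s) * \<beta>' s) - 2 * T"
proof -
  let ?t = "T * s"
  define X where "X = fst (velocity \<alpha> ?t)"
  define Y where "Y = snd (velocity \<alpha> ?t)"
  define P where "P = omega_x \<mu> (\<alpha> ?t)"
  define Q where "Q = omega_y \<mu> (\<alpha> ?t)"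
  have np: "\<alpha> ?t \<notin> primaries \<mu>"
    using solution by (simp add: pcr3bp_solution_def)
  have acc: "fst (velocity (velocity \<alpha>) ?t) = P + 2 * Y" "snd (velocity (velocity \<alpha>) ?t) = Q - 2 * X"
    using solution by (simp_all add: pcr3bp_solution_def partial_omega[OF np] P_def Q_def X_def Y_def)
  have E: "2 * omega \<mu> (\<alpha> ?t) - C = X\<^sup>2 + Y\<^sup>2"
    using velocity_norm[of ?t] by (simp add: X_def Y_def)
  have "X\<^sup>2 + Y\<^sup>2 > 0"
  proof -
    have "\<alpha> ?t \<in> hill_interior \<mu> C"
      using closure_subset_hill unfolding range_eq by blast
    then show ?thesis
      by (simp only: hill_interior_def mem_Collect_eq E)
  qed
  have b: "Re (\<beta>' s) = T * X" "Im (\<beta>' s) = T * Y" "Re (\<beta>'' s) = T\<^sup>2 * (P + 2 * Y)" "Im (\<beta>'' s) = T\<^sup>2 * (Q - 2 * X)"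
    by (simp_all add: \<beta>'_def \<beta>''_def to_complex_def acc X_def[symmetric] Y_def[symmetric])
  have "Im (\<beta>'' s / \<beta>' s) = (T\<^sup>2 * (Q - 2 * X) * (T * X) - T\<^sup>2 * (P + 2 * Y) * (T * Y)) / ((T * X)\<^sup>2 + (T * Y)\<^sup>2)"
    by (simp add: Im_divide b)
  also have "(T * X)\<^sup>2 + (T * Y)\<^sup>2 = T\<^sup>2 * (X\<^sup>2 + Y\<^sup>2)"
    by (simp add: algebra_simps power_mult_distrib)
  \<comment> \<open>The Coriolis terms add up to \<open>- 2 * (X\<^sup>2 + Y\<^sup>2)\<close>, a
    multiple of the denominator, and split off as a constant. The Jacobian integral turns the
    remaining denominator into that of \<open>ln_speed_x\<close> and
    \<open>ln_speed_y\<close>.\<close>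
  also have "T\<^sup>2 * (Q - 2 * X) * (T * X) - T\<^sup>2 * (P + 2 * Y) * (T * Y) = T\<^sup>2 * (T * (X * Q - Y * P) - 2 * T * (X\<^sup>2 + Y\<^sup>2))"
    by (simp add: algebra_simps power2_eq_square)
  also have "\<dots> / (T\<^sup>2 * (X\<^sup>2 + Y\<^sup>2)) = T * (X * Q - Y * P) / (X\<^sup>2 + Y\<^sup>2) - 2 * T"
  proof -
    have "T\<^sup>2 * (A - 2 * T * S) / (T\<^sup>2 * S) = A / S - 2 * T" if "S > 0" for A S
      using T that by (simp add: diff_divide_distrib)
    then show ?thesis
      using \<open>X\<^sup>2 + Y\<^sup>2 > 0\<close> by blast
  qed
  also have "T * (X * Q - Y * P) / (X\<^sup>2 + Y\<^sup>2) = - Im (grad (\<beta> s) * \<beta>' s)"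
    by (simp add: grad_def ln_speed_x_def ln_speed_y_def b \<beta>_def E P_def[symmetric] Q_def[symmetric]
        diff_divide_distrib algebra_simps)
  finally show ?thesis .
qed

text \<open>The integral of \<open>Im (\<beta>'' s / \<beta>' s)\<close> over one period is
  evaluated twice: as \<open>2 * pi * w\<close> by the Umlaufsatz, and through
  \<open>turning_rate\<close> as minus the flux, minus \<open>2 * T\<close>. Keeping
  \<open>w\<close> as a variable treats both orientations at once.\<close>

lemma total_turning:
  fixes w :: real
  assumes w: "\<And>p. p \<in> enclosed_region \<alpha> \<Longrightarrow> winding_number (period_loop \<alpha> T) (to_complex p) = w"
    "w = 1 \<or> w = -1"
  shows "2 * pi * w = - w * integral (enclosed_region \<alpha>) (laplacian (\<lambda>p. ln (speed \<mu> C p))) - 2 * T"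
proof -
  let ?\<Omega> = "inside (range \<beta>)" and ?\<Delta> = "laplacian (\<lambda>p. ln (speed \<mu> C p))"
  let ?V = "hill_interior \<mu> C"
  have w': "winding_number (\<lambda>s. to_complex (\<beta> s)) (to_complex p) = w" if "p \<in> ?\<Omega>" for p
    using w(1) that by (simp add: enclosed_eq period_loop_def[abs_def] \<beta>_def[abs_def])
  define gx where "gx p = Complex (ln_speed_xx \<mu> C p) (- ln_speed_xy \<mu> C p)" for p
  define gy where "gy p = Complex (ln_speed_xy \<mu> C p) (- ln_speed_yy \<mu> C p)" for p
  have vd: "((\<lambda>t. Complex (u t) (- v t)) has_vector_derivative Complex u' (- v')) (at t)"
    if "(u has_real_derivative u') (at t)" "(v has_real_derivative v') (at t)" for u v u' v' t
    using that unfolding Complex_eq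
    by (auto intro!: derivative_eq_intros has_vector_derivative_of_real)
  have cont_Complex: "continuous_on S (\<lambda>p. Complex (u p) (- v p))"
    if "continuous_on S u" "continuous_on S v" for S :: "(real \<times> real) set" and u v
    unfolding Complex_eq by (intro continuous_intros that)
  define J where "J = integral ?\<Omega> (\<lambda>p. gx p + \<i> * gy p)"
  have cg: "continuous_on ?V grad" "continuous_on ?V gx" "continuous_on ?V gy"
    unfolding grad_def[abs_def] gx_def gy_def by (intro cont_Complex continuous_on_ln_speed)+
  have green: "integral {0..1} (\<lambda>s. grad (\<beta> s) * \<beta>' s) = \<i> * w * J"
    unfolding J_def
  proof (rule green_loop[OF open_hill_interior closure_subset_hill _ _ cg w'])
    fix x y assume p: "(x, y) \<in> ?V"
    show "((\<lambda>x. grad (x, y)) has_vector_derivative gx (x, y)) (at x)"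
      "((\<lambda>y. grad (x, y)) has_vector_derivative gy (x, y)) (at y)"
      unfolding grad_def gx_def gy_def
      by (rule vd[OF DERIV_ln_speed(3)[OF p] DERIV_ln_speed(5)[OF p]]
          vd[OF DERIV_ln_speed(4)[OF p] DERIV_ln_speed(6)[OF p]])+
  qed
  have cont_gb: "continuous_on {0..1} (\<lambda>s. grad (\<beta> s) * \<beta>' s)"
    by (intro continuous_on_mult continuous_on_compose2[OF cg(1)] continuous_on_subset[OF continuous_on_\<beta>]
        continuous_on_subset[OF cont]) (use closure_subset_hill in auto)
  then have "((\<lambda>s. grad (\<beta> s) * \<beta>' s) has_integral (\<i> * w * J)) {0..1}"
    using green by (metis integrable_continuous_interval integrable_integral)
  \<comment> \<open>The imaginary part of \<open>\<i> * w * J\<close> is \<open>w * Re J\<close>,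
    and \<open>Re J\<close> turns out to be the integral of the Laplacian.\<close>
  from has_integral_linear[OF this bounded_linear_Im]
  have flux: "((\<lambda>s. Im (grad (\<beta> s) * \<beta>' s)) has_integral w * Re J) {0..1}"
    by (simp add: o_def)
  have "(\<lambda>p. gx p + \<i> * gy p) absolutely_integrable_on ?\<Omega>"
  proof (rule absolutely_integrable_on_subset_compact[OF compact_enclosed_closure])
    show "continuous_on (?\<Omega> \<union> range \<beta>) (\<lambda>p. gx p + \<i> * gy p)"
      by (intro continuous_intros continuous_on_subset[OF cg(2) closure_subset_hill]
          continuous_on_subset[OF cg(3) closure_subset_hill])
  qed (use open_enclosed in auto)
  then have "((\<lambda>p. gx p + \<i> * gy p) has_integral J) ?\<Omega>"
    by (simp add: J_def absolutely_integrable_on_def integrable_integral)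
  from has_integral_linear[OF this bounded_linear_Re]
  have "((\<lambda>p. ln_speed_xx \<mu> C p + ln_speed_yy \<mu> C p) has_integral Re J) ?\<Omega>"
    by (simp add: o_def gx_def gy_def)
  then have "(?\<Delta> has_integral Re J) ?\<Omega>"
    by (rule has_integral_eq[rotated]) (use closure_subset_hill laplacian_ln_speed in \<open>auto simp: subset_iff\<close>)
  then have lap: "integral (enclosed_region \<alpha>) ?\<Delta> = Re J"
    unfolding enclosed_eq by (rule integral_unique)
  from has_integral_linear[OF umlaufsatz[OF deriv_\<beta>' w' w(2)] bounded_linear_Im]
  have "((\<lambda>s. - Im (grad (\<beta> s) * \<beta>' s) - 2 * T) has_integral (2 * pi * w)) {0..1}"
    by (simp add: o_def turning_rate)
  moreover have "((\<lambda>s. - Im (grad (\<beta> s) * \<beta>' s) - 2 * T) has_integral (- (w * Re J) - 2 * T)) {0..1}"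
    using has_integral_const_real[of "2 * T" 0 1] by (intro has_integral_diff has_integral_neg flux) simp
  ultimately have "2 * pi * w = - (w * Re J) - 2 * T"
    by (rule has_integral_unique)
  then show ?thesis
    unfolding lap by simp
qed

end

theorem theorem2p3:
  fixes \<mu> C T :: real and \<alpha> :: "real \<Rightarrow> real \<times> real"
  assumes "0 < \<mu>" and "\<mu> \<le> 1 / 2"
    and "pcr3bp_solution \<mu> \<alpha>"
    and "jacobian_integral \<mu> \<alpha> C"
    and "0 < T" and "\<forall>t. \<alpha> (t + T) = \<alpha> t"
    and "\<forall>t. norm (velocity \<alpha> t) \<noteq> 0"
    and "inj_on \<alpha> {0..<T}"
    and "enclosed_region \<alpha> \<subseteq> U \<mu> C"
    and ln_defined: "\<forall>p \<in> enclosed_region \<alpha>. speed \<mu> C p > 0"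
  shows "laplacian (\<lambda>p. ln (speed \<mu> C p)) absolutely_integrable_on enclosed_region \<alpha>
    \<and> (goes_clockwise \<alpha> T \<longrightarrow>
        2 * T = 2 * pi + integral (enclosed_region \<alpha>) (laplacian (\<lambda>p. ln (speed \<mu> C p))))
    \<and> (goes_counterclockwise \<alpha> T \<longrightarrow>
        2 * T = - 2 * pi - integral (enclosed_region \<alpha>) (laplacian (\<lambda>p. ln (speed \<mu> C p))))"
proof -
  interpret pcr3bp_loop \<mu> C T \<alpha>
    using assms by unfold_locales auto
  have "laplacian (\<lambda>p. ln (speed \<mu> C p)) absolutely_integrable_on enclosed_region \<alpha>"
    unfolding enclosed_eq by (rule absolutely_integrable_laplacian)
  \<comment> \<open>With \<open>L\<close> for the integral of the Laplacian, \<open>w = -1\<close>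
    gives \<open>- 2 * pi = L - 2 * T\<close>, and \<open>w = 1\<close> gives
    \<open>2 * pi = - L - 2 * T\<close>.\<close>
  moreover have "2 * T = 2 * pi + integral (enclosed_region \<alpha>) (laplacian (\<lambda>p. ln (speed \<mu> C p)))"
    if "goes_clockwise \<alpha> T"
    using total_turning[of "-1"] that by (simp add: goes_clockwise_def)
  moreover have "2 * T = - 2 * pi - integral (enclosed_region \<alpha>) (laplacian (\<lambda>p. ln (speed \<mu> C p)))"
    if "goes_counterclockwise \<alpha> T"
    using total_turning[of 1] that by (simp add: goes_counterclockwise_def)
  ultimately show ?thesis
    by blast
qed

end
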